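(* Let $n\ge1$. The map $\Phi$ (defined in the context) is a bijection from the set of staircase tableaux $\mathcal{T}$ of size $n$ without label $\delta$ and without weight $q$ to the set of lazy paths of size $n$. Moreover, for the lazy path $\Phi(\mathcal{T})$, denote by $D(\Phi(\mathcal{T}))$ the number of $(1,-1)$ steps, by $M(\Phi(\mathcal{T}))$ the number of $(1,1)$ steps, by $A(\Phi(\mathcal{T}))$ the length of the initial maximal sequence of $(1,1)$ steps, by $H(\Phi(\mathcal{T}))$ the number of $(2,0)$ steps, by $F(\Phi(\mathcal{T}))$ the number of factors, and by $N(\Phi(\mathcal{T}))$ the number of negative factors in $\Phi(\mathcal{T})$. Then: - the number of $\gamma$ labels in $\mathcal{T}$ is given by $N(\Phi(\mathcal{T}))$; - the number of $\alpha$ labels in $\mathcal{T}$ is given by $M(\Phi(\mathcal{T}))-N(\Phi(\mathcal{T}))$; - the number of $\beta$ labels in $\mathcal{T}$ is given by $D(\Phi(\mathcal{T}))+H(\Phi(\mathcal{T}))-A(\Phi(\mathcal{T}))$; - the number of columns indexed by $\beta$ in $\mathcal{T}$ is given by $H(\Phi(\mathcal{T}))$; - the number of rows indexed by $\alpha$ or $\gamma$ in $\mathcal{T}$ is given by $A(\Phi(\mathcal{T}))$.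
   Context: **Staircase tableaux.** A staircase tableau $\mathcal{T}$ of size $n$ is a Ferrers diagram of shape $(n,n-1,\dots,2,1)$ (English convention) whose boxes are either empty or labeled with one of $\alpha,\beta,\gamma,\delta$, such that: no box along the diagonal (the last box of each row) is empty; all boxes in the same row and to the left of a $\beta$ or a $\delta$ are empty; all boxes in the same column and above an $\alpha$ or a $\gamma$ are empty. A row (resp. column) is indexed by a label $\ell$ if its left-most (resp. top-most) label is $\ell$. **Weight.** Every blank box is assigned $q$ or $1$ according to the closest labeled box to its right in its row and the closest labeled box below it in its column: if it sees a $\beta$ to its right it gets $1$; if it sees a $\delta$ to its right it gets $q$; if it sees an $\alpha$ or $\gamma$ to its right and an $\alpha$ or $\delta$ below it, it gets $1$; if it sees an $\alpha$ or $\gamma$ to its right and a $\beta$ or $\gamma$ below it, it gets $q$. "Without weight $q$" means that no blank box gets $q$. **Lazy paths.** A lazy path of size $n$ is a path on $\mathbb{Z}\times\mathbb{Z}$ from $(0,0)$ to $(2n,0)$ with steps $(1,1)$, $(1,-1)$ or $(2,0)$, whose steps $(2,0)$ occur only on the horizontal axis (ordinate $0$). A factor of a path is a minimal (nonempty) sub-path starting on the axis and ending on the axis; it is positive (resp. negative) if it lies strictly above (resp. below) the axis except at its endpoints. **The map $\Phi$.** Let $\mathcal{T}$ be a staircase tableau of size $n$ without label $\delta$ and without weight $q$. Index its boxes by $(i,j)$, $i,j\ge1$, $i+j\le n+1$ ($i$ = row from the top, $j$ = column from the left). (1) Add a row $0$ and a column $0$, to get an array of cells $(i,j)$ with $i,j\ge0$,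 $i+j\le n+1$. Label by $1$ the cells $(0,0)$, $(0,n+1)$, $(n+1,0)$; each cell $(0,j)$, $1\le j\le n$, such that the top-most label in column $j$ of $\mathcal{T}$ is $\beta$ (or $\delta$); and each cell $(i,0)$, $1\le i\le n$, such that the left-most label in row $i$ of $\mathcal{T}$ is $\alpha$ or $\gamma$. The other cells of row $0$ and column $0$ are left empty. (2) The labeled cells are the nodes of a binary tree $B$ with root $(0,0)$: the labeled cells with $i+j=n+1$ are the external nodes, the labeled cells with $i+j<n+1$ are the internal nodes; the right son of an internal node is the next labeled cell to its right in its row, and its left son is the next labeled cell below it in its column. (This tree has $n+1$ internal nodes and $n+2$ external nodes.) The left depth of a node $v$ is the number of left sons on the path from the root to $v$. Each internal node of left depth $1$ is assigned the label ($\alpha$ or $\gamma$) carried by its right son in the array. (3) Traverse $B$ in preorder (node, then left subtree, then right subtree), omitting the root and the last two external nodes visited, and write a step $(1,1)$ for each internal node and a step $(1,-1)$ for each external node. This gives a path from $(0,0)$ to $(2n,0)$ with ordinates $\ge-1$. Replace each negative factor (a step $(1,-1)$ followed by $(1,1)$) by a step $(2,0)$. (4) Each positive factor of the resulting path begins with the step $(1,1)$ of an internal node of left depth $1$. Leave the factor unchanged if this node was assigned $\alpha$, and reflect it across the horizontal axis if this node was assigned $\gamma$. The resulting lazy path is $\Phi(\mathcal{T})$.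
   Formalization: A(Φ(T)) is the length of the initial run of (1,1) steps, except that if the first factor is negative the initial run of (1,-1) steps is counted; read literally the β and row claims fail (n=1, single label γ: A=0 but one row is indexed by γ). *)

theory Defs
  imports Main
begin

section \<open>Staircase tableaux\<close>

datatype label = Alpha | Beta | Gamma | Delta

text \<open>Cells are pairs (row from the top, column from the left). The boxes of a tableau have both
  coordinates at least 1; row 0 and column 0 are used by the augmented array below.\<close>

type_synonym cell = "nat \<times> nat"

type_synonym tableau = "cell \<Rightarrow> label option"

definition boxes :: "nat \<Rightarrow> cell set" where
  "boxes n = {(i, j). 1 \<le> i \<and> 1 \<le> j \<and> i + j \<le> n + 1}"

definition staircase_tableau :: "nat \<Rightarrow> tableau \<Rightarrow> bool" where
  "staircase_tableau n T \<longleftrightarrow>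
     dom T \<subseteq> boxes n \<and>
     (\<forall>(i, j)\<in>boxes n. i + j = n + 1 \<longrightarrow> T (i, j) \<noteq> None) \<and>
     (\<forall>i j j'. T (i, j) \<in> {Some Beta, Some Delta} \<and> j' < j \<longrightarrow> T (i, j') = None) \<and>
     (\<forall>i j i'. T (i, j) \<in> {Some Alpha, Some Gamma} \<and> i' < i \<longrightarrow> T (i', j) = None)"

definition row_indexed_by :: "tableau \<Rightarrow> nat \<Rightarrow> label \<Rightarrow> bool" where
  "row_indexed_by T i l \<longleftrightarrow> (\<exists>j. T (i, j) = Some l \<and> (\<forall>j'<j. T (i, j') = None))"

definition column_indexed_by :: "tableau \<Rightarrow> nat \<Rightarrow> label \<Rightarrow> bool" where
  "column_indexed_by T j l \<longleftrightarrow> (\<exists>i. T (i, j) = Some l \<and> (\<forall>i'<i. T (i', j) = None))"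

definition num_label :: "label \<Rightarrow> tableau \<Rightarrow> nat" where
  "num_label l T = card {c. T c = Some l}"

definition sees_right :: "tableau \<Rightarrow> cell \<Rightarrow> label \<Rightarrow> bool" where
  "sees_right T c l \<longleftrightarrow> (case c of (i, j) \<Rightarrow>
     \<exists>j'>j. T (i, j') = Some l \<and> (\<forall>k. j < k \<and> k < j' \<longrightarrow> T (i, k) = None))"

definition sees_below :: "tableau \<Rightarrow> cell \<Rightarrow> label \<Rightarrow> bool" where
  "sees_below T c l \<longleftrightarrow> (case c of (i, j) \<Rightarrow>
     \<exists>i'>i. T (i', j) = Some l \<and> (\<forall>k. i < k \<and> k < i' \<longrightarrow> T (k, j) = None))"

text \<open>As no diagonal box is empty, every blank box of a staircase tableau sees exactly one label to
  its right and exactly one below. A blank box that does not get \<open>q\<close> gets \<open>1\<close>.\<close>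

definition gets_q :: "tableau \<Rightarrow> cell \<Rightarrow> bool" where
  "gets_q T c \<longleftrightarrow>
     sees_right T c Delta \<or>
     (sees_right T c Alpha \<or> sees_right T c Gamma) \<and> (sees_below T c Beta \<or> sees_below T c Gamma)"

definition tableaux_no_delta_no_q :: "nat \<Rightarrow> tableau set" where
  "tableaux_no_delta_no_q n =
     {T. staircase_tableau n T \<and> Delta \<notin> ran T \<and>
         (\<forall>c\<in>boxes n. T c = None \<longrightarrow> \<not> gets_q T c)}"

section \<open>Lazy paths\<close>

text \<open>A path is given by its sequence of steps \<open>Up = (1,1)\<close>, \<open>Down = (1,-1)\<close>, \<open>Flat = (2,0)\<close>,
  starting at \<open>(0,0)\<close>.\<close>

datatype step = Up | Down | Flat

fun step_x :: "step \<Rightarrow> int" where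
  "step_x Up = 1"
| "step_x Down = 1"
| "step_x Flat = 2"

fun step_y :: "step \<Rightarrow> int" where
  "step_y Up = 1"
| "step_y Down = -1"
| "step_y Flat = 0"

definition height :: "step list \<Rightarrow> int" where
  "height p = sum_list (map step_y p)"

definition lazy_paths :: "nat \<Rightarrow> step list set" where
  "lazy_paths n =
     {p. sum_list (map step_x p) = 2 * int n \<and> height p = 0 \<and>
         (\<forall>k<length p. p ! k = Flat \<longrightarrow> height (take k p) = 0)}"

text \<open>\<open>cut_at_axis y h w\<close> cuts \<open>w\<close>, starting at ordinate \<open>h\<close>, after each step that ends on the axis,
  where \<open>y\<close> gives the vertical displacements. The elements of \<open>w\<close> may carry more data than a step.\<close>

fun cut_at_axis :: "('a \<Rightarrow> int) \<Rightarrow> int \<Rightarrow> 'a list \<Rightarrow> 'a list list" where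
  "cut_at_axis y h [] = []"
| "cut_at_axis y h (s # w) =
     (if h + y s = 0 then [s] # cut_at_axis y 0 w
      else (case cut_at_axis y (h + y s) w of
              [] \<Rightarrow> [[s]]
            | f # fs \<Rightarrow> (s # f) # fs))"

definition factors :: "step list \<Rightarrow> step list list" where
  "factors p = cut_at_axis step_y 0 p"

text \<open>The factor \<open>[Flat]\<close> lies on the axis, hence is neither positive nor negative; without the
  conjunct \<open>Flat \<notin> set f\<close> it would satisfy both conditions vacuously.\<close>

definition positive_factor :: "step list \<Rightarrow> bool" where
  "positive_factor f \<longleftrightarrow> Flat \<notin> set f \<and> (\<forall>k. 0 < k \<and> k < length f \<longrightarrow> height (take k f) > 0)"

definition negative_factor :: "step list \<Rightarrow> bool" where
  "negative_factor f \<longleftrightarrow> Flat \<notin> set f \<and> (\<forall>k. 0 < k \<and> k < length f \<longrightarrow> height (take k f) < 0)"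

definition num_steps :: "step \<Rightarrow> step list \<Rightarrow> nat" where
  "num_steps s p = length (filter (\<lambda>t. t = s) p)"

definition num_negative_factors :: "step list \<Rightarrow> nat" where
  "num_negative_factors p = length (filter negative_factor (factors p))"

text \<open>The length of the initial maximal sequence of \<open>(1,1)\<close> steps, where a negative first factor is
  read in its unreflected form, so that there the initial \<open>(1,-1)\<close> steps are counted. (Counting
  \<open>(1,1)\<close> steps in the reflected factor would give 0: for the tableau of size 1 with label \<open>\<gamma>\<close>, whose
  path is \<open>(1,-1), (1,1)\<close>, this is not the number of rows indexed by \<open>\<alpha>\<close> or \<open>\<gamma>\<close>.)\<close>

definition initial_run :: "step list \<Rightarrow> nat" where
  "initial_run p =
     (if p \<noteq> [] \<and> negative_factor (hd (factors p))
      then length (takeWhile (\<lambda>s. s = Down) p)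
      else length (takeWhile (\<lambda>s. s = Up) p))"

section \<open>The map \<open>\<Phi>\<close>\<close>

definition marked_cells :: "nat \<Rightarrow> tableau \<Rightarrow> cell set" where
  "marked_cells n T =
     {(0, 0), (0, n + 1), (n + 1, 0)}
     \<union> {(0, j) | j. 1 \<le> j \<and> j \<le> n \<and> (column_indexed_by T j Beta \<or> column_indexed_by T j Delta)}
     \<union> {(i, 0) | i. 1 \<le> i \<and> i \<le> n \<and> (row_indexed_by T i Alpha \<or> row_indexed_by T i Gamma)}"

definition labeled_cells :: "nat \<Rightarrow> tableau \<Rightarrow> cell set" where
  "labeled_cells n T = marked_cells n T \<union> dom T"

definition right_son :: "cell set \<Rightarrow> cell \<Rightarrow> cell option" where
  "right_son S c = (case c of (i, j) \<Rightarrow>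
     if \<exists>j'>j. (i, j') \<in> S then Some (i, LEAST j'. j < j' \<and> (i, j') \<in> S) else None)"

definition left_son :: "cell set \<Rightarrow> cell \<Rightarrow> cell option" where
  "left_son S c = (case c of (i, j) \<Rightarrow>
     if \<exists>i'>i. (i', j) \<in> S then Some (LEAST i'. i < i' \<and> (i', j) \<in> S, j) else None)"

lemma right_son_less: "right_son S c = Some d \<Longrightarrow> fst c + snd c < fst d + snd d"
  by (auto simp: right_son_def split: prod.splits if_splits) (metis (mono_tags, lifting) LeastI)

lemma left_son_less: "left_son S c = Some d \<Longrightarrow> fst c + snd c < fst d + snd d"
  by (auto simp: left_son_def split: prod.splits if_splits) (metis (mono_tags, lifting) LeastI)

datatype bintree = External (cell_of: cell) | Internal (cell_of: cell) (left: bintree) (right: bintree)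

text \<open>The subtree rooted at \<open>c\<close> of the tree on the labeled cells \<open>S\<close>. For the array of a tableau,
  a labeled cell above the antidiagonal always has both sons; the second occurrence of \<open>External\<close>
  only makes the function total.\<close>

function subtree_at :: "nat \<Rightarrow> cell set \<Rightarrow> cell \<Rightarrow> bintree" where
  "subtree_at n S c =
     (if fst c + snd c < n + 1
      then (case left_son S c of
              Some l \<Rightarrow> (case right_son S c of
                          Some r \<Rightarrow> Internal c (subtree_at n S l) (subtree_at n S r)
                        | None \<Rightarrow> External c)
            | None \<Rightarrow> External c)
      else External c)"
  by auto
termination
  by (relation "measure (\<lambda>(n, S, c). n + 1 - (fst c + snd c))")
     (auto dest!: right_son_less left_son_less)

declare subtree_at.simps [simp del]

definition tree_of :: "nat \<Rightarrow> tableau \<Rightarrow> bintree" where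
  "tree_of n T = subtree_at n (labeled_cells n T) (0, 0)"

text \<open>The nodes in preorder. Each node is represented by its left depth and the subtree rooted at it;
  the first argument is the left depth of the root of the given tree.\<close>

fun preorder :: "nat \<Rightarrow> bintree \<Rightarrow> (nat \<times> bintree) list" where
  "preorder d (External c) = [(d, External c)]"
| "preorder d (Internal c l r) = (d, Internal c l r) # preorder (d + 1) l @ preorder d r"

fun node_step :: "bintree \<Rightarrow> step" where
  "node_step (External c) = Down"
| "node_step (Internal c l r) = Up"

fun node_label :: "tableau \<Rightarrow> nat \<times> bintree \<Rightarrow> label option" where
  "node_label T (d, External c) = None"
| "node_label T (d, Internal c l r) = (if d = 1 then T (cell_of r) else None)"

text \<open>The last two nodes in the preorder of a tree with at least one internal node are external, so
  removing them is the same as removing the last two external nodes.\<close>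

lemma preorder_last: "\<exists>xs d' c'. preorder d t = xs @ [(d', External c')]"
  by (induction t arbitrary: d) (auto, metis append_Cons append_assoc)

lemma preorder_last_two:
  "\<exists>xs d' c' d'' c''. preorder d (Internal c l r) = xs @ [(d', External c'), (d'', External c'')]"
proof (induction r arbitrary: d c l)
  case (External c1)
  show ?case using preorder_last[of "d + 1" l] by fastforce
next
  case (Internal c1 l1 r1)
  obtain xs d' c' d'' c'' where
    "preorder d (Internal c1 l1 r1) = xs @ [(d', External c'), (d'', External c'')]"
    using Internal.IH(2) by blast
  then have "preorder d (Internal c l (Internal c1 l1 r1)) =
      ((d, Internal c l (Internal c1 l1 r1)) # preorder (d + 1) l @ xs)
        @ [(d', External c'), (d'', External c'')]"
    by simp
  then show ?case by blast
qed

text \<open>Steps are paired with the label assigned to their node, which is needed for the reflections.\<close>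

type_synonym lstep = "step \<times> label option"

definition traversal_path :: "nat \<Rightarrow> tableau \<Rightarrow> lstep list" where
  "traversal_path n T =
     map (\<lambda>v. (node_step (snd v), node_label T v))
         (butlast (butlast (tl (preorder 0 (tree_of n T)))))"

definition lfactors :: "lstep list \<Rightarrow> lstep list list" where
  "lfactors w = cut_at_axis (step_y \<circ> fst) 0 w"

definition flatten_negative :: "lstep list \<Rightarrow> lstep list" where
  "flatten_negative w =
     concat (map (\<lambda>f. if negative_factor (map fst f) then [(Flat, None)] else f) (lfactors w))"

fun reflect_step :: "step \<Rightarrow> step" where
  "reflect_step Up = Down"
| "reflect_step Down = Up"
| "reflect_step Flat = Flat"

definition reflect_gamma :: "lstep list \<Rightarrow> step list" where
  "reflect_gamma w =
     concat (map (\<lambda>f. if positive_factor (map fst f) \<and> snd (hd f) = Some Gamma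
                       then map (reflect_step \<circ> fst) f
                       else map fst f) (lfactors w))"

definition Phi :: "nat \<Rightarrow> tableau \<Rightarrow> step list" where
  "Phi n T = reflect_gamma (flatten_negative (traversal_path n T))"

end

theory Submission
  imports Defs
begin

text \<open>In the array of a tableau, a labeled box with \<open>\<beta>\<close> has a labeled cell above it in its column
  (the mark in row 0 if nothing else) and none to its left in its row; for \<open>\<alpha>\<close> and \<open>\<gamma>\<close> it is the
  other way round. So \<open>\<beta>\<close> labels are exactly left sons and \<open>\<alpha>\<close>, \<open>\<gamma>\<close> labels exactly right sons, and a
  tableau is determined by its set \<open>S\<close> of labeled cells and its set \<open>G\<close> of \<open>\<gamma>\<close> cells.

  The absence of \<open>q\<close> has two effects. A blank box with labeled cells on its left and above it would
  see \<open>\<alpha>\<close> or \<open>\<gamma>\<close> to its right and \<open>\<beta>\<close> below, hence would get \<open>q\<close>. So the edges of the tree do not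
  cross, and by \<open>noncrossing_tree_iff\<close> the sets \<open>S\<close> that arise are the planar drawings of the binary
  trees with \<open>n + 2\<close> leaves, one for each tree. Moreover the boxes above a \<open>\<gamma>\<close> must not see \<open>\<alpha>\<close> or
  \<open>\<gamma>\<close> to their right, which means that no horizontal edge other than one in row 0 passes above the
  \<open>\<gamma>\<close>. The horizontal edges above a right son come from the ancestors having it in their left
  subtree, so their number is the left depth, and \<open>\<gamma>\<close> may stand exactly at the right sons of the nodes
  of left depth 1 (\<open>gamma_cells_shape_of\<close>). Conversely, each planar tree with an arbitrary choice of
  \<open>\<gamma>\<close> at these places is the array of a tableau of the required kind.

  Such a decorated tree is the same as a sequence of \<^emph>\<open>pieces\<close>: in preorder, the internal nodes of
  left depth 1 become \<^emph>\<open>hills\<close>, each carrying its choice of \<open>\<gamma>\<close> or \<open>\<alpha>\<close> and its left subtree, and the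
  internal nodes of left depth 0 other than the root become \<^emph>\<open>bars\<close>. Sequences of pieces correspond bijectively to lazy paths
  (\<open>bij_betw_pieces_word\<close>), a hill being a positive or negative factor and a bar a horizontal step, and
  \<open>\<Phi>\<close> maps the tableau of a sequence of pieces to its path (\<open>Phi_tableau_of_pieces\<close>). As every tableau
  comes from a sequence of pieces, \<open>\<Phi>\<close> is a bijection.

  For the statistics, note that each of the \<open>n + 1\<close> internal nodes has one left and one right son. The
  \<open>\<beta>\<close> labels are the left sons outside column 0, the \<open>\<alpha>\<close> and \<open>\<gamma>\<close> labels are the right sons outside
  row 0, and the cells of column 0 and of row 0 form the left and the right spine of the tree, which
  are read off the path as the initial run of up steps and the horizontal steps.\<close>

section \<open>Binary trees and lazy paths\<close>

datatype shape = Tip | Fork shape shape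

fun leaves :: "shape \<Rightarrow> nat" where
  "leaves Tip = 1"
| "leaves (Fork l r) = leaves l + leaves r"

lemma leaves_pos [simp]: "0 < leaves t"
  by (induction t) auto

lemma leaves_neq_0 [simp]: "leaves t \<noteq> 0"
  using leaves_pos[of t] by linarith

text \<open>The contribution of a whole subtree to the preorder traversal: a path that ends one unit below its
  start and does not go below its start earlier.\<close>

fun tree_word :: "shape \<Rightarrow> step list" where
  "tree_word Tip = [Down]"
| "tree_word (Fork l r) = Up # tree_word l @ tree_word r"

text \<open>A factor of a lazy path. The shape of a hill is the one whose word follows the initial step of the
  unreflected factor; the Boolean tells whether the factor is reflected, that is, whether the
  corresponding label is \<open>\<gamma>\<close>.\<close>

datatype piece = Bar | Hill bool shape

fun piece_size :: "piece \<Rightarrow> nat" where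
  "piece_size Bar = 1"
| "piece_size (Hill g t) = leaves t"

fun piece_word :: "piece \<Rightarrow> step list" where
  "piece_word Bar = [Flat]"
| "piece_word (Hill g t) = (if g then map reflect_step (Up # tree_word t) else Up # tree_word t)"

definition pieces_size :: "piece list \<Rightarrow> nat" where
  "pieces_size ps = sum_list (map piece_size ps)"

definition pieces_word :: "piece list \<Rightarrow> step list" where
  "pieces_word ps = concat (map piece_word ps)"

lemma pieces_word_simps [simp]:
  "pieces_word [] = []"
  "pieces_word (p # ps) = piece_word p @ pieces_word ps"
  by (simp_all add: pieces_word_def)

lemma pieces_size_simps [simp]:
  "pieces_size [] = 0"
  "pieces_size (p # ps) = piece_size p + pieces_size ps"
  by (simp_all add: pieces_size_def)

lemma height_simps [simp]:
  "height [] = 0"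
  "height (s # p) = step_y s + height p"
  "height (p @ p') = height p + height p'"
  by (simp_all add: height_def)

lemma height_reflect: "height (map reflect_step p) = - height p"
proof (induction p)
  case (Cons s p)
  then show ?case by (cases s) auto
qed simp

lemma height_tree_word [simp]: "height (tree_word t) = -1"
  by (induction t) auto

lemma Flat_notin_tree_word [simp]: "Flat \<notin> set (tree_word t)"
  by (induction t) auto

lemma height_take_tree_word: "k < length (tree_word t) \<Longrightarrow> 0 \<le> height (take k (tree_word t))"
proof (induction t arbitrary: k)
  case (Fork l r)
  show ?case
  proof (cases k)
    case (Suc m)
    show ?thesis
    proof (cases "m < length (tree_word l)")
      case True
      then show ?thesis using Fork.IH(1)[of m] Suc by simp
    next
      case False
      then show ?thesis using Fork.IH(2)[of "m - length (tree_word l)"] Fork.prems Suc by auto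
    qed
  qed simp
qed simp

lemma tree_word_prefix_free:
  "tree_word t @ v = tree_word t' @ v' \<Longrightarrow> t = t' \<and> v = v'"
proof (induction t arbitrary: t' v v')
  case Tip
  then show ?case by (cases t') auto
next
  case (Fork l r)
  obtain l' r' where t': "t' = Fork l' r'" using Fork.prems by (cases t') auto
  then have "tree_word l @ (tree_word r @ v) = tree_word l' @ (tree_word r' @ v')"
    using Fork.prems by simp
  from Fork.IH(1)[OF this] have l: "l = l'" "tree_word r @ v = tree_word r' @ v'" by auto
  from Fork.IH(2)[OF l(2)] show ?case using l t' by simp
qed

text \<open>Going down by \<open>m\<close> or more, a path visits the ordinate one unit below its start for a first time,
  and the part up to there is a tree word by the usual first-passage decomposition. The depth \<open>m\<close> of
  the axis, on which all horizontal steps lie, is a parameter because after an up step the same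
  argument is applied at depth \<open>m + 1\<close>.\<close>

lemma tree_word_parse:
  assumes "0 < m" "height w \<le> - m" "\<forall>k<length w. w ! k = Flat \<longrightarrow> height (take k w) = - m"
  shows "\<exists>t v. w = tree_word t @ v"
  using assms
proof (induction "length w" arbitrary: w m rule: less_induct)
  case less
  show ?case
  proof (cases w)
    case Nil
    then show ?thesis using less.prems by simp
  next
    case (Cons s w')
    show ?thesis
    proof (cases s)
      case Flat
      then show ?thesis using less.prems(1) less.prems(3)[rule_format, of 0] Cons by simp
    next
      case Down
      then have "w = tree_word Tip @ w'" using Cons by simp
      then show ?thesis by blast
    next
      case Up
      have flat: "\<forall>k<length w'. w' ! k = Flat \<longrightarrow> height (take k w') = - (m + 1)"
      proof (intro allI impI)
        fix k assume "k < length w'" "w' ! k = Flat"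
        then show "height (take k w') = - (m + 1)"
          using less.prems(3)[rule_format, of "Suc k"] Cons Up by simp
      qed
      obtain l u where u: "w' = tree_word l @ u"
        using less.hyps[of w' "m + 1"] less.prems flat Cons Up by auto
      have "\<forall>k<length u. u ! k = Flat \<longrightarrow> height (take k u) = - m"
      proof (intro allI impI)
        fix k assume "k < length u" "u ! k = Flat"
        then show "height (take k u) = - m"
          using flat[rule_format, of "length (tree_word l) + k"] u by (simp add: nth_append)
      qed
      then obtain r v where "u = tree_word r @ v"
        using less.hyps[of u m] less.prems u Cons Up by auto
      then have "w = tree_word (Fork l r) @ v" using u Cons Up by simp
      then show ?thesis by blast
    qed
  qed
qed

lemma reflect_step_reflect [simp]: "reflect_step (reflect_step s) = s"
  by (cases s) auto

lemma reflect_step_eq_Flat [simp]: "reflect_step s = Flat \<longleftrightarrow> s = Flat"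
  by (cases s) auto

lemma step_x_reflect [simp]: "step_x (reflect_step s) = step_x s"
  by (cases s) auto

lemma piece_word_not_Nil [simp]: "piece_word p \<noteq> []"
  by (cases p) auto

lemma inj_reflect_step: "inj reflect_step"
  by (metis injI reflect_step_reflect)

text \<open>The first step tells the kind of piece and the sign of a hill; what follows is then determined
  because tree words are prefix-free.\<close>

lemma piece_word_prefix_free:
  assumes "piece_word p @ v = piece_word p' @ v'"
  shows "p = p' \<and> v = v'"
proof (cases p; cases p')
  fix g t g' t' assume p: "p = Hill g t" "p' = Hill g' t'"
  show ?thesis
  proof (cases g)
    case True
    then have g': "g'" using assms p by (cases g') auto
    have "map reflect_step (map reflect_step (tree_word t) @ v)
        = map reflect_step (map reflect_step (tree_word t') @ v')"
      using assms p True g' by simp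
    then have "tree_word t @ map reflect_step v = tree_word t' @ map reflect_step v'"
      by (simp add: comp_def)
    from tree_word_prefix_free[OF this] show ?thesis
      using p True g' inj_reflect_step by (simp add: inj_map_eq_map)
  next
    case False
    then have "\<not> g'" using assms p by (cases g') auto
    then show ?thesis using False assms p tree_word_prefix_free by auto
  qed
qed (use assms in \<open>auto split: if_splits\<close>)

lemma pieces_word_inject: "pieces_word ps = pieces_word ps' \<Longrightarrow> ps = ps'"
proof (induction ps arbitrary: ps')
  case Nil
  then show ?case by (cases ps') auto
next
  case (Cons p ps)
  then show ?case by (cases ps') (auto dest: piece_word_prefix_free)
qed

text \<open>The condition on horizontal steps in the definition of lazy paths, isolated because it is
  compatible with concatenation of paths that return to the axis.\<close>

definition flats_on_axis :: "step list \<Rightarrow> bool" where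
  "flats_on_axis w \<longleftrightarrow> (\<forall>k<length w. w ! k = Flat \<longrightarrow> height (take k w) = 0)"

lemma flats_on_axis_append:
  assumes "height u = 0"
  shows "flats_on_axis (u @ v) \<longleftrightarrow> flats_on_axis u \<and> flats_on_axis v"
proof
  assume *: "flats_on_axis (u @ v)"
  show "flats_on_axis u \<and> flats_on_axis v"
    unfolding flats_on_axis_def
  proof (intro conjI allI impI)
    fix k assume "k < length u" "u ! k = Flat"
    then show "height (take k u) = 0"
      using *[unfolded flats_on_axis_def, rule_format, of k] by (simp add: nth_append)
  next
    fix k assume "k < length v" "v ! k = Flat"
    then show "height (take k v) = 0"
      using *[unfolded flats_on_axis_def, rule_format, of "length u + k"] assms
      by (simp add: nth_append)
  qed
next
  assume *: "flats_on_axis u \<and> flats_on_axis v"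
  then show "flats_on_axis (u @ v)"
    unfolding flats_on_axis_def
    by (auto simp: nth_append assms split: if_splits)
qed

lemma height_piece_word [simp]: "height (piece_word p) = 0"
  by (cases p) (auto simp: height_reflect)

lemma flats_on_axis_piece_word: "flats_on_axis (piece_word p)"
proof (cases p)
  case Bar
  then show ?thesis by (simp add: flats_on_axis_def)
next
  case (Hill g t)
  have "Flat \<notin> set (piece_word p)" using Hill by auto (metis Flat_notin_tree_word reflect_step_eq_Flat)
  then show ?thesis unfolding flats_on_axis_def by (metis nth_mem)
qed

lemma sum_step_x_tree_word: "sum_list (map step_x (tree_word t)) = 2 * int (leaves t) - 1"
  by (induction t) auto

lemma step_x_reflect_comp [simp]: "step_x \<circ> reflect_step = step_x"
  by auto

lemma sum_step_x_piece_word [simp]: "sum_list (map step_x (piece_word p)) = 2 * int (piece_size p)"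
  by (cases p) (auto simp: sum_step_x_tree_word)

lemma lazy_paths_eq:
  "lazy_paths n = {p. sum_list (map step_x p) = 2 * int n \<and> height p = 0 \<and> flats_on_axis p}"
  by (simp add: lazy_paths_def flats_on_axis_def)

lemma pieces_word_lazy: "pieces_word ps \<in> lazy_paths (pieces_size ps)"
  by (induction ps)
     (auto simp: lazy_paths_eq flats_on_axis_append flats_on_axis_piece_word,
      simp add: flats_on_axis_def)

lemma height_map_reflect_take: "height (take k (map reflect_step w)) = - height (take k w)"
  by (simp add: take_map height_reflect)

lemma flats_on_axis_reflect: "flats_on_axis (map reflect_step w) \<longleftrightarrow> flats_on_axis w"
  by (simp add: flats_on_axis_def height_map_reflect_take)

lemma Up_parse:
  assumes "height (Up # w) = 0" "flats_on_axis (Up # w)"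
  shows "\<exists>t v. w = tree_word t @ v"
proof (rule tree_word_parse[of 1])
  show "\<forall>k<length w. w ! k = Flat \<longrightarrow> height (take k w) = - 1"
  proof (intro allI impI)
    fix k assume "k < length w" "w ! k = Flat"
    then show "height (take k w) = - 1"
      using assms(2)[unfolded flats_on_axis_def, rule_format, of "Suc k"] by simp
  qed
qed (use assms in auto)

text \<open>The three kinds of first step. If it is a down step, the reflected path is parsed instead.\<close>

lemma piece_parse:
  assumes "height w = 0" "flats_on_axis w" "w \<noteq> []"
  shows "\<exists>p v. w = piece_word p @ v"
proof (cases w)
  case (Cons s w')
  show ?thesis
  proof (cases s)
    case Flat
    then have "w = piece_word Bar @ w'" using Cons by simp
    then show ?thesis by blast
  next
    case Up
    then obtain t v where "w' = tree_word t @ v" using Up_parse assms Cons by blast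
    then have "w = piece_word (Hill False t) @ v" using Cons Up by simp
    then show ?thesis by blast
  next
    case Down
    then have "map reflect_step w = Up # map reflect_step w'" using Cons by simp
    then have "height (Up # map reflect_step w') = 0" "flats_on_axis (Up # map reflect_step w')"
      using assms flats_on_axis_reflect[of w] height_reflect[of w] by simp_all
    then obtain t v where "map reflect_step w' = tree_word t @ v" using Up_parse by blast
    then have "map reflect_step (map reflect_step w') = map reflect_step (tree_word t @ v)" by simp
    then have "w' = map reflect_step (tree_word t) @ map reflect_step v" by (simp add: comp_def)
    then have "w = piece_word (Hill True t) @ map reflect_step v" using Cons Down by simp
    then show ?thesis by blast
  qed
qed (use assms in simp)

lemma pieces_word_surj: "height w = 0 \<Longrightarrow> flats_on_axis w \<Longrightarrow> \<exists>ps. w = pieces_word ps"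
proof (induction "length w" arbitrary: w rule: less_induct)
  case less
  show ?case
  proof (cases "w = []")
    case True
    then have "w = pieces_word []" by simp
    then show ?thesis by blast
  next
    case False
    then obtain p v where w: "w = piece_word p @ v" using piece_parse less.prems by blast
    moreover have "length v < length w" using w piece_word_not_Nil[of p] by (cases "piece_word p") auto
    moreover have "height v = 0" "flats_on_axis v"
      using less.prems w by (simp_all add: flats_on_axis_append)
    ultimately obtain ps where "v = pieces_word ps" using less.hyps by blast
    then have "w = pieces_word (p # ps)" using w by simp
    then show ?thesis by blast
  qed
qed

lemma bij_betw_pieces_word:
  "bij_betw pieces_word {ps. pieces_size ps = n} (lazy_paths n)"
  unfolding bij_betw_def
proof
  show "inj_on pieces_word {ps. pieces_size ps = n}"
    using pieces_word_inject by (auto simp: inj_on_def)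
  show "pieces_word ` {ps. pieces_size ps = n} = lazy_paths n"
  proof
    show "pieces_word ` {ps. pieces_size ps = n} \<subseteq> lazy_paths n" using pieces_word_lazy by auto
    show "lazy_paths n \<subseteq> pieces_word ` {ps. pieces_size ps = n}"
    proof
      fix w assume w: "w \<in> lazy_paths n"
      then obtain ps where ps: "w = pieces_word ps"
        using pieces_word_surj by (auto simp: lazy_paths_eq)
      have "pieces_size ps = n" using w pieces_word_lazy[of ps] ps by (simp add: lazy_paths_eq)
      then show "w \<in> pieces_word ` {ps. pieces_size ps = n}" using ps by blast
    qed
  qed
qed

section \<open>Binary trees as noncrossing sets of cells\<close>

text \<open>The planar drawing of a tree with root at \<open>(i, j)\<close>: the leaves fill, from bottom left to top right,
  the antidiagonal cells of the quadrant of \<open>(i, j)\<close>, and each node stands in the column of its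
  leftmost and in the row of its rightmost leaf. The left son is moved down by the number of leaves of
  the right subtree, so that the leaves of the right subtree fit in the rows above it; symmetrically
  for the right son.\<close>

fun cells :: "nat \<Rightarrow> nat \<Rightarrow> shape \<Rightarrow> cell set" where
  "cells i j Tip = {(i, j)}"
| "cells i j (Fork l r) = insert (i, j) (cells (i + leaves r) j l \<union> cells i (j + leaves l) r)"

fun bintree_at :: "nat \<Rightarrow> nat \<Rightarrow> shape \<Rightarrow> bintree" where
  "bintree_at i j Tip = External (i, j)"
| "bintree_at i j (Fork l r) = Internal (i, j) (bintree_at (i + leaves r) j l) (bintree_at i (j + leaves l) r)"

lemma cell_of_bintree_at [simp]: "cell_of (bintree_at i j t) = (i, j)"
  by (cases t) auto

definition has_above :: "cell set \<Rightarrow> nat \<Rightarrow> nat \<Rightarrow> bool" where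
  "has_above S x y \<longleftrightarrow> (\<exists>x'<x. (x', y) \<in> S)"

definition has_left :: "cell set \<Rightarrow> nat \<Rightarrow> nat \<Rightarrow> bool" where
  "has_left S x y \<longleftrightarrow> (\<exists>y'<y. (x, y') \<in> S)"

lemma root_in_cells [simp]: "(i, j) \<in> cells i j t"
  by (cases t) auto

lemma cells_bounds:
  "(x, y) \<in> cells i j t \<Longrightarrow> i \<le> x \<and> j \<le> y \<and> x + y < i + j + leaves t"
  by (induction t arbitrary: i j) fastforce+

lemma antidiagonal_in_cells:
  "i \<le> x \<Longrightarrow> j \<le> y \<Longrightarrow> x + y + 1 = i + j + leaves t \<Longrightarrow> (x, y) \<in> cells i j t"
proof (induction t arbitrary: i j)
  case (Fork l r)
  show ?case
  proof (cases "i + leaves r \<le> x")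
    case True
    then have "(x, y) \<in> cells (i + leaves r) j l" using Fork by auto
    then show ?thesis by simp
  next
    case False
    then have "(x, y) \<in> cells i (j + leaves l) r" using Fork by auto
    then show ?thesis by simp
  qed
qed auto

text \<open>The bounds of \<open>cells_bounds\<close> separate the two subtrees: a horizontal edge of one and a vertical edge
  of the other can only meet beyond the antidiagonal.\<close>

lemma cells_noncrossing:
  "x + y < i + j + leaves t \<Longrightarrow> has_left (cells i j t) x y \<Longrightarrow> has_above (cells i j t) x y \<Longrightarrow> False"
proof (induction t arbitrary: i j)
  case Tip
  then show ?case by (auto simp: has_left_def has_above_def)
next
  case (Fork l r)
  obtain y' where y': "y' < y" "(x, y') \<in> cells i j (Fork l r)"
    using Fork.prems by (auto simp: has_left_def)
  obtain x' where x': "x' < x" "(x', y) \<in> cells i j (Fork l r)"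
    using Fork.prems by (auto simp: has_above_def)
  have "i \<le> x'" "j \<le> y'" using cells_bounds x' y' by blast+
  then have "(x, y') \<in> cells (i + leaves r) j l \<or> (x, y') \<in> cells i (j + leaves l) r"
    "(x', y) \<in> cells (i + leaves r) j l \<or> (x', y) \<in> cells i (j + leaves l) r"
    using x' y' by auto
  then consider "(x, y') \<in> cells (i + leaves r) j l" "(x', y) \<in> cells (i + leaves r) j l"
    | "(x, y') \<in> cells i (j + leaves l) r" "(x', y) \<in> cells i (j + leaves l) r"
    | "(x, y') \<in> cells (i + leaves r) j l" "(x', y) \<in> cells i (j + leaves l) r"
    | "(x, y') \<in> cells i (j + leaves l) r" "(x', y) \<in> cells (i + leaves r) j l"
    by blast
  then show ?case
  proof cases
    case 1
    then have "has_left (cells (i + leaves r) j l) x y" "has_above (cells (i + leaves r) j l) x y"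
      using x'(1) y'(1) by (auto simp: has_left_def has_above_def)
    then show ?thesis using Fork.IH(1)[of "i + leaves r" j] Fork.prems(1) by auto
  next
    case 2
    then have "has_left (cells i (j + leaves l) r) x y" "has_above (cells i (j + leaves l) r) x y"
      using x'(1) y'(1) by (auto simp: has_left_def has_above_def)
    then show ?thesis using Fork.IH(2)[of i "j + leaves l"] Fork.prems(1) by auto
  next
    case 3
    then show ?thesis using cells_bounds[OF 3(1)] cells_bounds[OF 3(2)] Fork.prems(1) by simp
  next
    case 4
    then show ?thesis using cells_bounds[OF 4(1)] cells_bounds[OF 4(2)] x' y' by simp
  qed
qed

lemma cells_parent:
  "(x, y) \<in> cells i j t \<Longrightarrow> (x, y) \<noteq> (i, j) \<Longrightarrow> has_left (cells i j t) x y \<or> has_above (cells i j t) x y"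
proof (induction t arbitrary: i j)
  case (Fork l r)
  then consider "(x, y) \<in> cells (i + leaves r) j l" | "(x, y) \<in> cells i (j + leaves l) r" by auto
  then show ?case
  proof cases
    case 1
    show ?thesis
    proof (cases "(x, y) = (i + leaves r, j)")
      case True
      then have "i < x" "(i, y) = (i, j)" using leaves_pos[of r] by simp_all
      then show ?thesis by (auto simp: has_above_def)
    next
      case False
      then show ?thesis using Fork.IH(1)[OF 1] by (auto simp: has_above_def has_left_def)
    qed
  next
    case 2
    show ?thesis
    proof (cases "(x, y) = (i, j + leaves l)")
      case True
      then have "j < y" "(x, j) = (i, j)" using leaves_pos[of l] by simp_all
      then show ?thesis by (auto simp: has_left_def)
    next
      case False
      then show ?thesis using Fork.IH(2)[OF 2] by (auto simp: has_above_def has_left_def)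
    qed
  qed
qed auto

text \<open>The sets of cells that carry a planar drawing of a tree with \<open>N + 1\<close> leaves, in terms of the array.
  The fourth condition excludes crossings, and at the labeled cells it excludes that a cell is a son
  in two ways; the last one says that every cell except the root is a son.\<close>

definition noncrossing_tree :: "nat \<Rightarrow> cell set \<Rightarrow> bool" where
  "noncrossing_tree N S \<longleftrightarrow>
     (0, 0) \<in> S \<and>
     (\<forall>x y. (x, y) \<in> S \<longrightarrow> x + y \<le> N) \<and>
     (\<forall>x y. x + y = N \<longrightarrow> (x, y) \<in> S) \<and>
     (\<forall>x y. x + y \<le> N \<longrightarrow> \<not> (has_left S x y \<and> has_above S x y)) \<and>
     (\<forall>x y. (x, y) \<in> S \<longrightarrow> (x, y) \<noteq> (0, 0) \<longrightarrow> has_left S x y \<or> has_above S x y)"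

lemma noncrossing_tree_cells: "leaves t = N + 1 \<Longrightarrow> noncrossing_tree N (cells 0 0 t)"
  unfolding noncrossing_tree_def
  using cells_bounds[of _ _ 0 0 t] antidiagonal_in_cells[of 0 _ 0 _ t]
    cells_noncrossing[of _ _ 0 0 t] cells_parent[of _ _ 0 0 t]
  by (auto simp: less_Suc_eq_le)

text \<open>For \<open>i'\<close> and \<open>j'\<close> think of the row of the left son and the column of the right son of \<open>(i, j)\<close>.
  A cell strictly inside the rectangle would have a parent; the parent is again inside, since an edge
  entering the rectangle would cross one of the two edges leaving \<open>(i, j)\<close>. This gives an infinite
  descent.\<close>

lemma no_cell_between_sons:
  assumes "noncrossing_tree N S" "(i, j) \<in> S"
    and i': "\<forall>x. i < x \<and> x < i' \<longrightarrow> (x, j) \<notin> S"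
    and j': "\<forall>y. j < y \<and> y < j' \<longrightarrow> (i, y) \<notin> S"
  shows "(x, y) \<in> S \<Longrightarrow> i < x \<Longrightarrow> x < i' \<Longrightarrow> j < y \<Longrightarrow> y < j' \<Longrightarrow> False"
proof (induction "x + y" arbitrary: x y rule: less_induct)
  case less
  have cross: "\<not> (has_left S x y \<and> has_above S x y)" if "x + y \<le> N" for x y
    using assms(1) that by (auto simp: noncrossing_tree_def)
  have le: "x + y \<le> N" using assms(1) less.prems(1) by (auto simp: noncrossing_tree_def)
  have "has_left S x y \<or> has_above S x y"
    using assms(1) less.prems by (auto simp: noncrossing_tree_def)
  then show ?case
  proof
    assume "has_left S x y"
    then obtain y' where y': "y' < y" "(x, y') \<in> S" by (auto simp: has_left_def)
    consider "j < y'" | "y' = j" | "y' < j" by linarith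
    then show False
    proof cases
      case 1
      then show ?thesis using less.hyps[of x y'] less.prems y' by auto
    next
      case 2
      then show ?thesis using i' less.prems y' by auto
    next
      case 3
      then have "has_left S x j" "has_above S x j"
        using y' less.prems assms(2) by (auto simp: has_left_def has_above_def)
      then show ?thesis using cross[of x j] le less.prems by auto
    qed
  next
    assume "has_above S x y"
    then obtain x' where x': "x' < x" "(x', y) \<in> S" by (auto simp: has_above_def)
    consider "i < x'" | "x' = i" | "x' < i" by linarith
    then show False
    proof cases
      case 1
      then show ?thesis using less.hyps[of x' y] less.prems x' by auto
    next
      case 2
      then show ?thesis using j' less.prems x' by auto
    next
      case 3
      then have "has_left S i y" "has_above S i y"
        using x' less.prems assms(2) by (auto simp: has_left_def has_above_def)
      then show ?thesis using cross[of i y] le less.prems by auto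
    qed
  qed
qed

definition quadrant :: "nat \<Rightarrow> nat \<Rightarrow> cell set" where
  "quadrant i j = {(x, y). i \<le> x \<and> j \<le> y}"

text \<open>The part of \<open>S\<close> in the quadrant of a labeled cell is the drawing of a tree, by induction towards the
  antidiagonal. The point is that the two sons in positions \<open>(i', j)\<close> and \<open>(i, j')\<close> split the leaves
  of the quadrant without gap or overlap, that is, \<open>i' + j' = N + 1\<close>.\<close>

lemma noncrossing_tree_quadrant:
  assumes S: "noncrossing_tree N S"
  shows "(i, j) \<in> S \<Longrightarrow> \<exists>t. i + j + leaves t = N + 1 \<and> S \<inter> quadrant i j = cells i j t"
proof (induction "N - (i + j)" arbitrary: i j rule: less_induct)
  case less
  have le: "x + y \<le> N" if "(x, y) \<in> S" for x y using S that by (auto simp: noncrossing_tree_def)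
  have diag: "(x, y) \<in> S" if "x + y = N" for x y using S that by (auto simp: noncrossing_tree_def)
  show ?case
  proof (cases "i + j = N")
    case True
    then have "S \<inter> quadrant i j = cells i j Tip"
      using less.prems le by (fastforce simp: quadrant_def)
    then show ?thesis using True by (intro exI[of _ Tip]) auto
  next
    case False
    then have ij: "i + j < N" using le less.prems by fastforce
    define i' where "i' = (LEAST x. i < x \<and> (x, j) \<in> S)"
    define j' where "j' = (LEAST y. j < y \<and> (i, y) \<in> S)"
    have "i < N - j \<and> (N - j, j) \<in> S" using ij diag by auto
    then have "i < i' \<and> (i', j) \<in> S" unfolding i'_def by (rule LeastI)
    then have i': "i < i'" "(i', j) \<in> S" by simp_all
    have i'_min: "\<forall>x. i < x \<and> x < i' \<longrightarrow> (x, j) \<notin> S"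
      unfolding i'_def using not_less_Least by blast
    have "j < N - i \<and> (i, N - i) \<in> S" using ij diag by auto
    then have "j < j' \<and> (i, j') \<in> S" unfolding j'_def by (rule LeastI)
    then have j': "j < j'" "(i, j') \<in> S" by simp_all
    have j'_min: "\<forall>y. j < y \<and> y < j' \<longrightarrow> (i, y) \<notin> S"
      unfolding j'_def using not_less_Least by blast
    have empty: "(x, y) = (i, j)" if xy: "(x, y) \<in> S" "i \<le> x" "x < i'" "j \<le> y" "y < j'" for x y
    proof (rule ccontr)
      assume ne: "(x, y) \<noteq> (i, j)"
      consider "x = i" "j < y" | "i < x" "y = j" | "i < x" "j < y"
        using ne xy by (auto simp: le_less)
      then show False
      proof cases
        case 1
        then show ?thesis using j'_min xy by blast
      next
        case 2
        then show ?thesis using i'_min xy by blast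
      next
        case 3
        then show ?thesis using no_cell_between_sons[OF S less.prems i'_min j'_min xy(1)] xy by blast
      qed
    qed
    \<comment> \<open>The cell \<open>(i', j')\<close> has \<open>(i', j)\<close> on its left and \<open>(i, j')\<close> above it.\<close>
    have "\<not> i' + j' \<le> N"
    proof
      assume "i' + j' \<le> N"
      moreover have "has_left S i' j'" "has_above S i' j'"
        using i' j' by (auto simp: has_left_def has_above_def)
      ultimately show False using S by (auto simp: noncrossing_tree_def)
    qed
    \<comment> \<open>Otherwise the leaf in column \<open>j' - 1\<close> would lie above the left son and left of the right son.\<close>
    moreover have "\<not> N + 1 < i' + j'"
    proof
      assume *: "N + 1 < i' + j'"
      have "i + j' \<le> N" using le j' by blast
      have "(N + 1 - j', j' - 1) \<in> S"
        using \<open>i + j' \<le> N\<close> j'(1) by (intro diag) linarith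
      then have "(N + 1 - j', j' - 1) = (i, j)"
        using \<open>i + j' \<le> N\<close> * j'(1) by (intro empty) linarith+
      then have "N + 1 - j' = i" by simp
      then show False using \<open>i + j' \<le> N\<close> by linarith
    qed
    ultimately have sum: "i' + j' = N + 1" by linarith
    have "N - (i' + j) < N - (i + j)" "N - (i + j') < N - (i + j)" using i' j' ij by linarith+
    note IH = less.hyps[OF this(1) i'(2)] less.hyps[OF this(2) j'(2)]
    obtain l where l: "i' + j + leaves l = N + 1" "S \<inter> quadrant i' j = cells i' j l"
      using IH(1) by blast
    obtain r where r: "i + j' + leaves r = N + 1" "S \<inter> quadrant i j' = cells i j' r"
      using IH(2) by blast
    have i'_eq: "i' = i + leaves r" and j'_eq: "j' = j + leaves l" using sum l r by linarith+
    have "S \<inter> quadrant i j = insert (i, j) (S \<inter> quadrant i' j \<union> S \<inter> quadrant i j')"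
      using empty i' j' less.prems by (fastforce simp: quadrant_def)
    then have "S \<inter> quadrant i j = cells i j (Fork l r)"
      unfolding l(2) r(2) unfolding i'_eq j'_eq by simp
    moreover have "i + j + leaves (Fork l r) = N + 1" using sum l r by simp
    ultimately show ?thesis by blast
  qed
qed

lemma noncrossing_tree_iff:
  "noncrossing_tree N S \<longleftrightarrow> (\<exists>t. leaves t = N + 1 \<and> S = cells 0 0 t)"
proof
  assume S: "noncrossing_tree N S"
  then have "(0, 0) \<in> S" by (simp add: noncrossing_tree_def)
  from noncrossing_tree_quadrant[OF S this] show "\<exists>t. leaves t = N + 1 \<and> S = cells 0 0 t"
    by (auto simp: quadrant_def)
qed (use noncrossing_tree_cells in auto)

text \<open>In a planar drawing the next labeled cells below and to the right of a node are the roots of its two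
  subtrees, so that the search of \<open>subtree_at\<close> finds the tree that was drawn.\<close>

lemma subtree_at_eq_bintree_at:
  "i + j + leaves t = n + 2 \<Longrightarrow> S \<inter> quadrant i j = cells i j t \<Longrightarrow> subtree_at n S (i, j) = bintree_at i j t"
proof (induction t arbitrary: i j)
  case Tip
  then show ?case by (subst subtree_at.simps) simp
next
  case (Fork l r)
  let ?i = "i + leaves r" and ?j = "j + leaves l"
  have S: "(x, y) \<in> S \<longleftrightarrow> (x, y) = (i, j) \<or> (x, y) \<in> cells ?i j l \<or> (x, y) \<in> cells i ?j r"
    if "i \<le> x" "j \<le> y" for x y
    using Fork.prems(2) that by (auto simp: quadrant_def set_eq_iff)
  have pos: "0 < leaves l" "0 < leaves r" by simp_all
  have l: "S \<inter> quadrant ?i j = cells ?i j l"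
    using S cells_bounds[of _ _ ?i j l] cells_bounds[of _ _ i ?j r] pos Fork.prems
    by (fastforce simp: quadrant_def)
  have r: "S \<inter> quadrant i ?j = cells i ?j r"
    using S cells_bounds[of _ _ ?i j l] cells_bounds[of _ _ i ?j r] pos Fork.prems
    by (fastforce simp: quadrant_def)
  have sl: "left_son S (i, j) = Some (?i, j)"
  proof -
    have "(?i, j) \<in> S" using S[of ?i j] by simp
    moreover have "?i \<le> x" if "i < x" "(x, j) \<in> S" for x
      using that S[of x j] cells_bounds[of x j ?i j l] cells_bounds[of x j i ?j r] by auto
    ultimately have "(LEAST x. i < x \<and> (x, j) \<in> S) = ?i" by (intro Least_equality) auto
    moreover have "\<exists>x>i. (x, j) \<in> S" using \<open>(?i, j) \<in> S\<close> pos by (intro exI[of _ ?i]) auto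
    ultimately show ?thesis by (simp add: left_son_def)
  qed
  have sr: "right_son S (i, j) = Some (i, ?j)"
  proof -
    have "(i, ?j) \<in> S" using S[of i ?j] by simp
    moreover have "?j \<le> y" if "j < y" "(i, y) \<in> S" for y
      using that S[of i y] cells_bounds[of i y ?i j l] cells_bounds[of i y i ?j r] by auto
    ultimately have "(LEAST y. j < y \<and> (i, y) \<in> S) = ?j" by (intro Least_equality) auto
    moreover have "\<exists>y>j. (i, y) \<in> S" using \<open>(i, ?j) \<in> S\<close> pos by (intro exI[of _ ?j]) auto
    ultimately show ?thesis by (simp add: right_son_def)
  qed
  have "i + j < n + 1" using Fork.prems(1) pos by (simp del: leaves_pos)
  moreover have "subtree_at n S (?i, j) = bintree_at ?i j l" using Fork.IH(1)[OF _ l] Fork.prems(1) by simp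
  moreover have "subtree_at n S (i, ?j) = bintree_at i ?j r" using Fork.IH(2)[OF _ r] Fork.prems(1) by simp
  ultimately show ?case by (subst subtree_at.simps) (simp add: sl sr)
qed

section \<open>Tableaux as noncrossing sets of cells with a choice of gammas\<close>

text \<open>The cells of \<open>S\<close> at which \<open>\<gamma>\<close> is admissible: they are right sons outside row 0, and no horizontal
  edge passes above them except in row 0.\<close>

definition gamma_cells :: "cell set \<Rightarrow> cell set" where
  "gamma_cells S = {(x, y). (x, y) \<in> S \<and> 1 \<le> x \<and> has_left S x y \<and>
     (\<forall>x'. 1 \<le> x' \<and> x' < x \<longrightarrow> \<not> has_left S x' y)}"

text \<open>The labels are forced by the labeled cells except for the choice between \<open>\<alpha>\<close> and \<open>\<gamma>\<close>.\<close>

definition tableau_of :: "cell set \<Rightarrow> cell set \<Rightarrow> tableau" where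
  "tableau_of S G = (\<lambda>(x, y).
     if 1 \<le> x \<and> 1 \<le> y \<and> (x, y) \<in> S
     then Some (if has_above S x y then Beta else if (x, y) \<in> G then Gamma else Alpha)
     else None)"

lemma first_after:
  fixes a m :: nat
  assumes "P m" "a < m"
  shows "\<exists>k>a. P k \<and> (\<forall>j. a < j \<and> j < k \<longrightarrow> \<not> P j)"
proof -
  have "\<exists>k. a < k \<and> P k" using assms by blast
  then show ?thesis unfolding exists_least_iff[of "\<lambda>k. a < k \<and> P k"] by blast
qed

locale no_delta_no_q =
  fixes n :: nat and T :: tableau
  assumes T: "T \<in> tableaux_no_delta_no_q n"
begin

abbreviation "S \<equiv> labeled_cells n T"

lemma staircase: "staircase_tableau n T"
  using T unfolding tableaux_no_delta_no_q_def by (elim CollectE conjE)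

lemma dom:
  assumes "T (x, y) = Some l" shows "1 \<le> x \<and> 1 \<le> y \<and> x + y \<le> n + 1"
proof -
  have "dom T \<subseteq> boxes n" using staircase unfolding staircase_tableau_def by (elim conjE)
  moreover have "(x, y) \<in> dom T" using assms by (rule domI)
  ultimately have "(x, y) \<in> boxes n" by (rule subsetD)
  then show ?thesis by (simp add: boxes_def)
qed

lemma diagonal:
  assumes "1 \<le> x" "1 \<le> y" "x + y = n + 1" shows "T (x, y) \<noteq> None"
proof -
  have c: "(x, y) \<in> boxes n" using assms by (simp add: boxes_def)
  have "\<forall>(i, j)\<in>boxes n. i + j = n + 1 \<longrightarrow> T (i, j) \<noteq> None"
    using staircase unfolding staircase_tableau_def by (elim conjE)
  from bspec[OF this c] show ?thesis using assms(3) by simp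
qed

lemma no_Delta: "T c \<noteq> Some Delta"
  using T by (cases c) (auto simp: tableaux_no_delta_no_q_def ran_def)

lemma left_of_Beta: "T (x, y) = Some Beta \<Longrightarrow> y' < y \<Longrightarrow> T (x, y') = None"
  using T unfolding tableaux_no_delta_no_q_def staircase_tableau_def by blast

lemma not_Beta: "T c = Some l \<Longrightarrow> l \<noteq> Beta \<Longrightarrow> l = Alpha \<or> l = Gamma"
  using no_Delta[of c] by (cases l) auto

lemma above_Alpha_Gamma:
  "T (x, y) = Some l \<Longrightarrow> l \<noteq> Beta \<Longrightarrow> x' < x \<Longrightarrow> T (x', y) = None"
  using T not_Beta[of "(x, y)" l] unfolding tableaux_no_delta_no_q_def staircase_tableau_def by blast

lemma no_q: "1 \<le> x \<Longrightarrow> 1 \<le> y \<Longrightarrow> x + y \<le> n + 1 \<Longrightarrow> T (x, y) = None \<Longrightarrow> \<not> gets_q T (x, y)"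
  using T unfolding tableaux_no_delta_no_q_def boxes_def by blast

lemma in_S_inner: "1 \<le> x \<Longrightarrow> 1 \<le> y \<Longrightarrow> (x, y) \<in> S \<longleftrightarrow> T (x, y) \<noteq> None"
  by (auto simp: labeled_cells_def marked_cells_def)

lemma not_column_Delta: "\<not> column_indexed_by T y Delta"
  using no_Delta by (auto simp: column_indexed_by_def)

lemma T_row_0 [simp]: "T (0, y) = None"
  using dom[of 0 y] by fastforce

lemma T_column_0 [simp]: "T (x, 0) = None"
  using dom[of x 0] by fastforce

lemma in_S_row_0: "(0, y) \<in> S \<longleftrightarrow> y = 0 \<or> y = n + 1 \<or> 1 \<le> y \<and> y \<le> n \<and> column_indexed_by T y Beta"
  using not_column_Delta by (auto simp: labeled_cells_def marked_cells_def)

lemma in_S_column_0: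
  "(x, 0) \<in> S \<longleftrightarrow> x = 0 \<or> x = n + 1 \<or>
     1 \<le> x \<and> x \<le> n \<and> (row_indexed_by T x Alpha \<or> row_indexed_by T x Gamma)"
  by (auto simp: labeled_cells_def marked_cells_def)

text \<open>A \<open>\<beta>\<close> at the top of its column has the mark of row 0 above it. Above an \<open>\<alpha>\<close> or \<open>\<gamma>\<close> there is no
  label, and no mark either, since the column is indexed by a label that is not \<open>\<beta>\<close>.\<close>

lemma has_above_iff_Beta:
  assumes l: "T (x, y) = Some l"
  shows "has_above S x y \<longleftrightarrow> l = Beta"
proof
  assume "has_above S x y"
  then obtain x' where x': "x' < x" "(x', y) \<in> S" by (auto simp: has_above_def)
  show "l = Beta"
  proof (rule ccontr)
    assume l': "l \<noteq> Beta"
    show False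
    proof (cases "x' = 0")
      case True
      then have "column_indexed_by T y Beta" using x' in_S_row_0[of y] dom[OF l] by auto
      then obtain x'' where x'': "T (x'', y) = Some Beta" "\<forall>z<x''. T (z, y) = None"
        by (auto simp: column_indexed_by_def)
      then have "x'' \<noteq> x" "\<not> x < x''" using l l' by auto
      then show False using above_Alpha_Gamma[OF l l', of x''] x'' by auto
    next
      case False
      then show False
        using above_Alpha_Gamma[OF l l' x'(1)] x' dom[OF l] by (simp add: in_S_inner)
    qed
  qed
next
  assume l': "l = Beta"
  show "has_above S x y"
  proof (cases "\<exists>x'<x. T (x', y) \<noteq> None")
    case True
    then show ?thesis by (auto simp: has_above_def labeled_cells_def)
  next
    case False
    then have "(0, y) \<in> S" using l l' dom[OF l] by (auto simp: in_S_row_0 column_indexed_by_def)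
    moreover have "0 < x" using dom[OF l] by simp
    ultimately show ?thesis unfolding has_above_def by blast
  qed
qed

text \<open>The transposed argument: \<open>\<beta>\<close> empties its row to the left, and a row whose left-most label is \<open>\<alpha>\<close> or
  \<open>\<gamma>\<close> has a mark in column 0.\<close>

lemma has_left_iff_not_Beta:
  assumes l: "T (x, y) = Some l"
  shows "has_left S x y \<longleftrightarrow> l \<noteq> Beta"
proof
  assume "has_left S x y"
  then obtain y' where y': "y' < y" "(x, y') \<in> S" by (auto simp: has_left_def)
  show "l \<noteq> Beta"
  proof
    assume l': "l = Beta"
    show False
    proof (cases "y' = 0")
      case True
      then have "row_indexed_by T x Alpha \<or> row_indexed_by T x Gamma"
        using y' in_S_column_0[of x] dom[OF l] by auto
      then obtain y'' l'' where y'': "T (x, y'') = Some l''" "l'' \<noteq> Beta" "\<forall>z<y''. T (x, z) = None"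
        by (auto simp: row_indexed_by_def)
      then have "y'' \<noteq> y" "\<not> y < y''" using l l' by auto
      then show False using left_of_Beta[of x y y''] l l' y'' by auto
    next
      case False
      then show False
        using left_of_Beta[of x y y'] l l' y' dom[OF l] by (simp add: in_S_inner)
    qed
  qed
next
  assume l': "l \<noteq> Beta"
  show "has_left S x y"
  proof (cases "\<exists>y'<y. T (x, y') \<noteq> None")
    case True
    then show ?thesis by (auto simp: has_left_def labeled_cells_def)
  next
    case False
    then have "(x, 0) \<in> S" using l l' dom[OF l] not_Beta[OF l]
      by (auto simp: in_S_column_0 row_indexed_by_def)
    moreover have "0 < y" using dom[OF l] by simp
    ultimately show ?thesis unfolding has_left_def by blast
  qed
qed

text \<open>The cell on the left is also on the left of the first label seen to the right, which therefore is
  not \<open>\<beta>\<close>.\<close>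

lemma sees_right_Alpha_or_Gamma:
  assumes "1 \<le> x" "x + y < n + 1" "has_left S x y"
  shows "sees_right T (x, y) Alpha \<or> sees_right T (x, y) Gamma"
proof -
  obtain y0 where y0: "y0 < y" "(x, y0) \<in> S" using assms(3) by (auto simp: has_left_def)
  have "T (x, n + 1 - x) \<noteq> None" "y < n + 1 - x"
    using assms diagonal[of x "n + 1 - x"] by simp_all
  then obtain y1 where y1: "y < y1" "T (x, y1) \<noteq> None" "\<forall>k. y < k \<and> k < y1 \<longrightarrow> T (x, k) = None"
    using first_after[of "\<lambda>k. T (x, k) \<noteq> None" "n + 1 - x" y] by auto
  then obtain l where l: "T (x, y1) = Some l" by auto
  have "has_left S x y1" using y0 y1 by (auto simp: has_left_def)
  then have "l = Alpha \<or> l = Gamma" using has_left_iff_not_Beta[OF l] not_Beta[OF l] by simp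
  then show ?thesis using y1 l by (auto simp: sees_right_def)
qed

lemma sees_below_Beta:
  assumes "1 \<le> y" "x + y < n + 1" "has_above S x y"
  shows "sees_below T (x, y) Beta"
proof -
  obtain x0 where x0: "x0 < x" "(x0, y) \<in> S" using assms(3) by (auto simp: has_above_def)
  have "T (n + 1 - y, y) \<noteq> None" "x < n + 1 - y"
    using assms diagonal[of "n + 1 - y" y] by simp_all
  then obtain x1 where x1: "x < x1" "T (x1, y) \<noteq> None" "\<forall>k. x < k \<and> k < x1 \<longrightarrow> T (k, y) = None"
    using first_after[of "\<lambda>k. T (k, y) \<noteq> None" "n + 1 - y" x] by auto
  then obtain l where l: "T (x1, y) = Some l" by auto
  have "has_above S x1 y" using x0 x1 by (auto simp: has_above_def)
  then show ?thesis using has_above_iff_Beta[OF l] x1 l by (auto simp: sees_below_def)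
qed

text \<open>A blank box with a labeled cell on its left and one above it gets \<open>q\<close>.\<close>

lemma noncrossing:
  assumes "x + y \<le> n + 1" shows "\<not> (has_left S x y \<and> has_above S x y)"
proof
  assume *: "has_left S x y \<and> has_above S x y"
  then have pos: "1 \<le> x" "1 \<le> y" by (auto simp: has_left_def has_above_def)
  show False
  proof (cases "T (x, y)")
    case (Some l)
    then show ?thesis using * has_left_iff_not_Beta has_above_iff_Beta by blast
  next
    case None
    then have "x + y < n + 1" using assms diagonal[OF pos] by (cases "x + y = n + 1") auto
    then have "gets_q T (x, y)"
      using * pos sees_right_Alpha_or_Gamma sees_below_Beta by (auto simp: gets_q_def)
    then show ?thesis using no_q pos assms None by blast
  qed
qed

lemma noncrossing_tree_S: "noncrossing_tree (n + 1) S"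
  unfolding noncrossing_tree_def
proof (intro conjI allI impI)
  fix x y assume "(x, y) \<in> S"
  then show "x + y \<le> n + 1" using dom by (auto simp: labeled_cells_def marked_cells_def)
next
  fix x y assume *: "x + y = n + 1"
  show "(x, y) \<in> S"
  proof (cases "x = 0 \<or> y = 0")
    case True
    then show ?thesis using * by (auto simp: in_S_row_0 in_S_column_0)
  next
    case False
    then show ?thesis using * diagonal[of x y] by (simp add: in_S_inner)
  qed
next
  fix x y assume *: "(x, y) \<in> S" "(x, y) \<noteq> (0, 0)"
  consider "x = 0" "0 < y" | "y = 0" "0 < x" | "1 \<le> x" "1 \<le> y" using * by fastforce
  then show "has_left S x y \<or> has_above S x y"
  proof cases
    case 3
    then show ?thesis using * in_S_inner has_left_iff_not_Beta has_above_iff_Beta by blast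
  qed (auto simp: has_left_def has_above_def in_S_row_0 in_S_column_0)
qed (use noncrossing in \<open>auto simp: in_S_row_0\<close>)

text \<open>A horizontal edge passing above a \<open>\<gamma>\<close> in a row \<open>x' \<ge> 1\<close> makes the box in that row and in the column of
  the \<open>\<gamma>\<close> see \<open>\<alpha>\<close> or \<open>\<gamma>\<close> to its right and \<open>\<gamma>\<close> below.\<close>

lemma Gamma_subset: "{c. T c = Some Gamma} \<subseteq> gamma_cells S"
proof (clarify, unfold gamma_cells_def, clarify, intro conjI allI impI)
  fix x y assume g: "T (x, y) = Some Gamma"
  then show "1 \<le> x" "(x, y) \<in> S" using dom by (auto simp: in_S_inner)
  show "has_left S x y" using has_left_iff_not_Beta[OF g] by simp
  fix x' assume x': "1 \<le> x' \<and> x' < x"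
  show "\<not> has_left S x' y"
  proof
    assume "has_left S x' y"
    moreover have "x' + y < n + 1" "1 \<le> y" using dom[OF g] x' by auto
    moreover have none: "T (z, y) = None" if "z < x" for z using above_Alpha_Gamma[OF g] that by simp
    moreover have "sees_below T (x', y) Gamma" using x' g none by (auto simp: sees_below_def)
    ultimately have "gets_q T (x', y)" using x' sees_right_Alpha_or_Gamma by (auto simp: gets_q_def)
    then show False using no_q[of x' y] none x' dom[OF g] by auto
  qed
qed

lemma eq_tableau_of: "T = tableau_of S {c. T c = Some Gamma}"
proof
  fix c
  show "T c = tableau_of S {c. T c = Some Gamma} c"
  proof (cases c)
    case (Pair x y)
    show ?thesis
    proof (cases "T (x, y)")
      case None
      then show ?thesis using Pair by (auto simp: tableau_of_def in_S_inner)
    next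
      case (Some l)
      then show ?thesis
        using Pair dom[OF Some] has_above_iff_Beta[OF Some] not_Beta[OF Some]
        by (auto simp: tableau_of_def in_S_inner)
    qed
  qed
qed

end

text \<open>The converse direction: a planar tree with admissible places for \<open>\<gamma>\<close> is the array of a tableau.\<close>

locale noncrossing_tree_gammas =
  fixes n :: nat and S G :: "cell set"
  assumes S: "noncrossing_tree (n + 1) S" and G: "G \<subseteq> gamma_cells S"
begin

abbreviation "T \<equiv> tableau_of S G"

lemma root: "(0, 0) \<in> S"
  using S by (simp add: noncrossing_tree_def)

lemma in_S_le: "(x, y) \<in> S \<Longrightarrow> x + y \<le> n + 1"
  using S by (simp add: noncrossing_tree_def)

lemma diagonal_in_S: "x + y = n + 1 \<Longrightarrow> (x, y) \<in> S"
  using S by (simp add: noncrossing_tree_def)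

lemma S_noncrossing: "x + y \<le> n + 1 \<Longrightarrow> has_left S x y \<Longrightarrow> \<not> has_above S x y"
  using S by (simp add: noncrossing_tree_def)

lemma S_parent: "(x, y) \<in> S \<Longrightarrow> 1 \<le> x \<Longrightarrow> \<not> has_above S x y \<Longrightarrow> has_left S x y"
  using S by (auto simp: noncrossing_tree_def)

lemma S_left_iff: "(x, y) \<in> S \<Longrightarrow> 1 \<le> x \<Longrightarrow> has_left S x y \<longleftrightarrow> \<not> has_above S x y"
  using S_parent S_noncrossing in_S_le by blast

lemma T_eq_None_iff: "T (x, y) = None \<longleftrightarrow> \<not> (1 \<le> x \<and> 1 \<le> y \<and> (x, y) \<in> S)"
  by (auto simp: tableau_of_def)

lemma T_eq_Some_iff:
  "T (x, y) = Some l \<longleftrightarrow> 1 \<le> x \<and> 1 \<le> y \<and> (x, y) \<in> S \<and>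
     (if has_above S x y then l = Beta else if (x, y) \<in> G then l = Gamma else l = Alpha)"
  by (auto simp: tableau_of_def)

lemma T_staircase: "staircase_tableau n T"
  unfolding staircase_tableau_def
proof (intro conjI allI impI ballI)
  show "dom T \<subseteq> boxes n"
  proof
    fix c assume "c \<in> dom T"
    then show "c \<in> boxes n" using in_S_le by (cases c) (auto simp: dom_def T_eq_Some_iff boxes_def)
  qed
next
  fix c assume "c \<in> boxes n"
  then show "case c of (i, j) \<Rightarrow> i + j = n + 1 \<longrightarrow> T (i, j) \<noteq> None"
    using diagonal_in_S by (auto simp: boxes_def T_eq_None_iff)
next
  fix i j j' assume *: "T (i, j) \<in> {Some Beta, Some Delta} \<and> j' < j"
  then have "has_above S i j" "(i, j) \<in> S" "1 \<le> i" by (auto simp: T_eq_Some_iff split: if_splits)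
  then have "\<not> has_left S i j" using S_left_iff by blast
  then show "T (i, j') = None" using * by (auto simp: T_eq_None_iff has_left_def)
next
  fix i j i' assume *: "T (i, j) \<in> {Some Alpha, Some Gamma} \<and> i' < i"
  then have "\<not> has_above S i j" by (auto simp: T_eq_Some_iff split: if_splits)
  then show "T (i', j) = None" using * by (auto simp: T_eq_None_iff has_above_def)
qed

lemma T_no_Delta: "T c \<noteq> Some Delta"
  by (cases c) (auto simp: T_eq_Some_iff)

text \<open>The two ways of getting \<open>q\<close> without \<open>\<delta>\<close>: with \<open>\<beta>\<close> below, the box would be a crossing of two edges;
  with \<open>\<gamma>\<close> below, a horizontal edge would pass above an element of \<open>G\<close>.\<close>

lemma T_no_q:
  assumes c: "1 \<le> x" "1 \<le> y" "x + y \<le> n + 1" "T (x, y) = None"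
  shows "\<not> gets_q T (x, y)"
proof
  assume q: "gets_q T (x, y)"
  have "\<not> sees_right T (x, y) Delta" using T_no_Delta by (auto simp: sees_right_def)
  then have right: "sees_right T (x, y) Alpha \<or> sees_right T (x, y) Gamma"
    and below: "sees_below T (x, y) Beta \<or> sees_below T (x, y) Gamma"
    using q by (auto simp: gets_q_def)
  have nin: "(x, y) \<notin> S" using c by (simp add: T_eq_None_iff)
  obtain y' l where y': "y < y'" "T (x, y') = Some l" "l \<noteq> Beta"
      "\<forall>k. y < k \<and> k < y' \<longrightarrow> T (x, k) = None"
    using right by (auto simp: sees_right_def)
  then have "(x, y') \<in> S" "\<not> has_above S x y'" by (auto simp: T_eq_Some_iff split: if_splits)
  then have "has_left S x y'" using S_parent c by blast
  then obtain y0 where y0: "y0 < y'" "(x, y0) \<in> S" by (auto simp: has_left_def)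
  \<comment> \<open>Nothing is labeled between the box and the label seen, so the cell on the left of the label
    is already on the left of the box.\<close>
  have "y0 < y"
  proof (rule ccontr)
    assume "\<not> y0 < y"
    then have "y < y0" using nin y0(2) by (cases "y0 = y") auto
    then show False using y'(4) y0 c by (auto simp: T_eq_None_iff)
  qed
  then have left: "has_left S x y" using y0 by (auto simp: has_left_def)
  from below obtain x' l' where x': "x < x'" "T (x', y) = Some l'" "l' = Beta \<or> l' = Gamma"
      "\<forall>k. x < k \<and> k < x' \<longrightarrow> T (k, y) = None"
    by (auto simp: sees_below_def)
  from x'(3) show False
  proof
    assume "l' = Beta"
    then have "has_above S x' y" using x' by (auto simp: T_eq_Some_iff split: if_splits)
    then obtain x0 where x0: "x0 < x'" "(x0, y) \<in> S" by (auto simp: has_above_def)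
    have "x0 < x"
    proof (rule ccontr)
      assume "\<not> x0 < x"
      then have "x < x0" using nin x0(2) by (cases "x0 = x") auto
      then show False using x'(4) x0 c by (auto simp: T_eq_None_iff)
    qed
    then have "has_above S x y" using x0 by (auto simp: has_above_def)
    then show False using S_noncrossing left c by blast
  next
    assume "l' = Gamma"
    then have "(x', y) \<in> G" using x' by (auto simp: T_eq_Some_iff split: if_splits)
    then show False using G left x' c by (auto simp: gamma_cells_def)
  qed
qed

lemma T_in_tableaux: "T \<in> tableaux_no_delta_no_q n"
  using T_staircase T_no_Delta T_no_q
  by (auto simp: tableaux_no_delta_no_q_def ran_def boxes_def)

text \<open>The top-most label of a column is \<open>\<beta>\<close> iff something of \<open>S\<close> is above it, and that can only be in
  row 0. This recovers the marks from the labels, as does the next lemma for column 0.\<close>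

lemma column_indexed_iff:
  assumes "1 \<le> y" "y \<le> n" shows "column_indexed_by T y Beta \<longleftrightarrow> (0, y) \<in> S"
proof
  assume "column_indexed_by T y Beta"
  then obtain x where x: "T (x, y) = Some Beta" "\<forall>x'<x. T (x', y) = None"
    by (auto simp: column_indexed_by_def)
  then have "has_above S x y" by (auto simp: T_eq_Some_iff split: if_splits)
  then obtain x' where x': "x' < x" "(x', y) \<in> S" by (auto simp: has_above_def)
  moreover have "x' = 0" using x(2) x' assms by (auto simp: T_eq_None_iff not_le)
  ultimately show "(0, y) \<in> S" by simp
next
  assume 0: "(0, y) \<in> S"
  have "T (n + 1 - y, y) \<noteq> None" using assms by (auto simp: T_eq_None_iff intro!: diagonal_in_S)
  then have "\<exists>x. T (x, y) \<noteq> None" by blast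
  then obtain x where x: "T (x, y) \<noteq> None" "\<forall>x'<x. T (x', y) = None"
    unfolding exists_least_iff[of "\<lambda>x. T (x, y) \<noteq> None"] by blast
  then have "1 \<le> x" by (auto simp: T_eq_None_iff)
  then have "has_above S x y" using 0 by (auto simp: has_above_def intro!: exI[of _ 0])
  then have "T (x, y) = Some Beta" using x by (auto simp: T_eq_Some_iff T_eq_None_iff)
  then show "column_indexed_by T y Beta" using x by (auto simp: column_indexed_by_def)
qed

lemma row_indexed_iff:
  assumes "1 \<le> x" "x \<le> n"
  shows "row_indexed_by T x Alpha \<or> row_indexed_by T x Gamma \<longleftrightarrow> (x, 0) \<in> S"
proof
  assume "row_indexed_by T x Alpha \<or> row_indexed_by T x Gamma"
  then obtain y l where y: "T (x, y) = Some l" "l \<noteq> Beta" "\<forall>y'<y. T (x, y') = None"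
    by (auto simp: row_indexed_by_def)
  then have "has_left S x y" by (auto simp: T_eq_Some_iff S_parent split: if_splits)
  then obtain y' where y': "y' < y" "(x, y') \<in> S" by (auto simp: has_left_def)
  moreover have "y' = 0" using y(3) y' assms by (auto simp: T_eq_None_iff not_le)
  ultimately show "(x, 0) \<in> S" by simp
next
  assume 0: "(x, 0) \<in> S"
  have "T (x, n + 1 - x) \<noteq> None" using assms by (auto simp: T_eq_None_iff intro!: diagonal_in_S)
  then have "\<exists>y. T (x, y) \<noteq> None" by blast
  then obtain y where y: "T (x, y) \<noteq> None" "\<forall>y'<y. T (x, y') = None"
    unfolding exists_least_iff[of "\<lambda>y. T (x, y) \<noteq> None"] by blast
  then have "1 \<le> y" "(x, y) \<in> S" by (auto simp: T_eq_None_iff)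
  then have "has_left S x y" using 0 by (auto simp: has_left_def intro!: exI[of _ 0])
  then have "\<not> has_above S x y" using S_left_iff \<open>(x, y) \<in> S\<close> assms by blast
  then have "T (x, y) = Some Alpha \<or> T (x, y) = Some Gamma"
    using y by (auto simp: T_eq_Some_iff T_eq_None_iff)
  then show "row_indexed_by T x Alpha \<or> row_indexed_by T x Gamma"
    using y by (auto simp: row_indexed_by_def)
qed

lemma labeled_cells_T: "labeled_cells n T = S"
proof (rule set_eqI, clarify)
  fix x y :: nat
  interpret T: no_delta_no_q n T by unfold_locales (rule T_in_tableaux)
  consider "x = 0" | "y = 0" | "1 \<le> x" "1 \<le> y" by linarith
  then show "(x, y) \<in> labeled_cells n T \<longleftrightarrow> (x, y) \<in> S"
  proof cases
    case 1
    then show ?thesis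
      using column_indexed_iff[of y] root diagonal_in_S[of 0 y] in_S_le[of 0 y] T.in_S_row_0[of y]
      by (cases "y = 0 \<or> y = n + 1 \<or> y \<le> n") auto
  next
    case 2
    then show ?thesis
      using row_indexed_iff[of x] root diagonal_in_S[of x 0] in_S_le[of x 0] T.in_S_column_0[of x]
      by (cases "x = 0 \<or> x = n + 1 \<or> x \<le> n") auto
  next
    case 3
    then show ?thesis by (simp add: T.in_S_inner T_eq_None_iff del: One_nat_def)
  qed
qed

lemma Gamma_cells_T: "{c. T c = Some Gamma} = G"
proof -
  have "(x, y) \<in> G \<Longrightarrow> 1 \<le> x \<and> 1 \<le> y \<and> (x, y) \<in> S \<and> \<not> has_above S x y" for x y
    using G S_left_iff[of x y] by (auto simp: gamma_cells_def has_left_def)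
  then show ?thesis by (fastforce simp: T_eq_Some_iff split: if_splits)
qed

end

section \<open>The sequence of hills and bars of a tableau\<close>

text \<open>The two subtrees of the root of the tree encoded by a sequence of pieces. A hill is put on top of
  the left subtree, with the former left subtree as its right son: so the nodes of left depth 1 form
  right chains, which start at the left sons of the nodes of left depth 0. A bar starts a new such
  chain: it turns the root into the right son of a new root with an empty left subtree. Returning the
  two subtrees instead of the tree makes both steps simple.\<close>

fun sons_of :: "piece list \<Rightarrow> shape \<times> shape" where
  "sons_of [] = (Tip, Tip)"
| "sons_of (Bar # ps) = (Tip, case sons_of ps of (l, r) \<Rightarrow> Fork l r)"
| "sons_of (Hill g t # ps) = (case sons_of ps of (l, r) \<Rightarrow> (Fork t l, r))"

definition shape_of :: "piece list \<Rightarrow> shape" where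
  "shape_of ps = (case sons_of ps of (l, r) \<Rightarrow> Fork l r)"

lemma shape_of_eq: "sons_of ps = (l, r) \<Longrightarrow> shape_of ps = Fork l r"
  by (simp add: shape_of_def)

lemma leaves_shape_of: "leaves (shape_of ps) = pieces_size ps + 2"
  by (induction ps rule: sons_of.induct) (auto simp: shape_of_def split: prod.splits)

text \<open>The cell of the right son of each hill, with its Boolean, in the drawing with root at \<open>(0, j)\<close>. This
  cell is where the tableau carries the label of the hill. The rest of a sequence is drawn from column
  \<open>j + 1\<close> or \<open>j + leaves t\<close> on, and all its cells except possibly its root occur in the
  whole drawing.\<close>

fun hills :: "nat \<Rightarrow> piece list \<Rightarrow> (cell \<times> bool) list" where
  "hills j [] = []"
| "hills j (Bar # ps) = hills (j + 1) ps"
| "hills j (Hill g t # ps) =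
     ((leaves (snd (sons_of ps)), j + leaves t), g) # hills (j + leaves t) ps"

definition gammas_of :: "piece list \<Rightarrow> cell set" where
  "gammas_of ps = {c. (c, True) \<in> set (hills 0 ps)}"

lemma hills_column: "(c, g) \<in> set (hills j ps) \<Longrightarrow> j < snd c"
proof (induction j ps rule: hills.induct)
  case (3 j g' t ps)
  then show ?case using leaves_pos[of t] by fastforce
qed auto

lemma distinct_hills: "distinct (map fst (hills j ps))"
proof (induction j ps rule: hills.induct)
  case (3 j g t ps)
  then show ?case using hills_column[of _ _ "j + leaves t" ps] by fastforce
qed auto

lemma cells_disjoint_sons:
  "cells (i + leaves r) j l \<inter> cells i (j + leaves l) r = {}"
  using cells_bounds[of _ _ "i + leaves r" j l] cells_bounds[of _ _ i "j + leaves l" r] by fastforce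

lemma has_left_Un: "has_left (A \<union> B) x y \<longleftrightarrow> has_left A x y \<or> has_left B x y"
  by (auto simp: has_left_def)

lemma has_left_insert: "has_left (insert (a, b) A) x y \<longleftrightarrow> x = a \<and> b < y \<or> has_left A x y"
  by (auto simp: has_left_def)

lemma has_left_cells_bounds:
  "has_left (cells i j t) x y \<Longrightarrow> i \<le> x \<and> x < i + leaves t \<and> j < y"
  using cells_bounds[of x _ i j t] by (fastforce simp: has_left_def)

text \<open>A bar adds a root in row 0 and a leaf below it in the first column, beneath all other
  cells; neither gives a horizontal edge outside row 0.\<close>

lemma gamma_cells_Bar:
  "gamma_cells (cells 0 j (Fork Tip u)) = gamma_cells (cells 0 (j + 1) u)"
proof -
  let ?S' = "cells 0 j (Fork Tip u)" and ?S = "cells 0 (j + 1) u"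
  have below: "x < leaves u" "j < y" if "(x, y) \<in> ?S" for x y
    using cells_bounds[OF that] by linarith+
  have S': "?S' = insert (0, j) (insert (leaves u, j) ?S)" by auto
  have left: "has_left ?S' x y \<longleftrightarrow> has_left ?S x y" if "1 \<le> x" "x < leaves u" for x y
    using that unfolding S' by (simp add: has_left_insert)
  have no_left: "\<not> has_left ?S' x j" for x
    using below unfolding S' by (fastforce simp: has_left_def)
  have "(x, y) \<in> gamma_cells ?S' \<longleftrightarrow> (x, y) \<in> gamma_cells ?S" for x y
  proof
    assume g: "(x, y) \<in> gamma_cells ?S'"
    then have "(x, y) \<in> ?S" using no_left unfolding gamma_cells_def S' by auto
    with g show "(x, y) \<in> gamma_cells ?S"
      using left below[of x y] unfolding gamma_cells_def by auto
  next
    assume g: "(x, y) \<in> gamma_cells ?S"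
    then have "(x, y) \<in> ?S" unfolding gamma_cells_def by auto
    with g show "(x, y) \<in> gamma_cells ?S'"
      using left below[of x y] unfolding gamma_cells_def by auto
  qed
  then show ?thesis by auto
qed

text \<open>A hill adds a horizontal edge in row \<open>leaves r\<close>, which leads to the root of \<open>l\<close>, and the tree \<open>t\<close>
  below it. The root of \<open>l\<close> becomes admissible, no cell of \<open>t\<close> is admissible because of the new edge,
  and the new edge excludes no other cell that was admissible, since below row \<open>leaves r\<close> the cells of
  \<open>l\<close> are already beneath an edge of the right chain starting at the root of \<open>l\<close>. In the proof, \<open>?A\<close>,
  \<open>?B\<close>, \<open>?C\<close> are the cells of \<open>t\<close>, \<open>l\<close>, \<open>r\<close>.\<close>

lemma gamma_cells_Hill:
  "gamma_cells (cells 0 j (Fork (Fork t l) r)) =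
     insert (leaves r, j + leaves t) (gamma_cells (cells 0 (j + leaves t) (Fork l r)))"
proof -
  let ?a = "leaves r" and ?k = "j + leaves t"
  let ?A = "cells (?a + leaves l) j t" and ?B = "cells ?a ?k l" and ?C = "cells 0 (?k + leaves l) r"
  let ?S' = "cells 0 j (Fork (Fork t l) r)" and ?S = "cells 0 ?k (Fork l r)"
  have S': "?S' = insert (0, j) (insert (?a, j) (?A \<union> ?B \<union> ?C))"
    by (auto simp: add.assoc)
  have S: "?S = insert (0, ?k) (?B \<union> ?C)" by simp
  have pos: "1 \<le> ?a" using leaves_pos[of r] by linarith
  have A: "?a + leaves l \<le> x" "?a < x" if "(x, y) \<in> ?A" for x y
    using cells_bounds[OF that] leaves_pos[of l] by linarith+
  have B: "?a \<le> x" "x < ?a + leaves l" "?k \<le> y" if "(x, y) \<in> ?B" for x y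
    using cells_bounds[OF that] by linarith+
  have C: "x < ?a" if "(x, y) \<in> ?C" for x y
    using cells_bounds[OF that] by linarith+
  have left': "has_left ?S' x y \<longleftrightarrow>
      x = ?a \<and> j < y \<or> has_left ?A x y \<or> has_left ?B x y \<or> has_left ?C x y" if "1 \<le> x" for x y
    using that unfolding S' by (auto simp: has_left_insert has_left_Un)
  have left: "has_left ?S x y \<longleftrightarrow> has_left ?B x y \<or> has_left ?C x y" if "1 \<le> x" for x y
    using that unfolding S by (auto simp: has_left_insert has_left_Un)
  have lA: "?a + leaves l \<le> x \<and> ?a < x \<and> j < y" if "has_left ?A x y" for x y
    using has_left_cells_bounds[OF that] leaves_pos[of l] by linarith
  have lB: "?a \<le> x \<and> ?k < y \<and> j < y" if "has_left ?B x y" for x y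
    using has_left_cells_bounds[OF that] by linarith
  have lC: "x < ?a \<and> ?k < y \<and> j < y" if "has_left ?C x y" for x y
    using has_left_cells_bounds[OF that] leaves_pos[of l] by linarith
  have left_a: "has_left ?B ?a y" if "?k < y" for y
    using that root_in_cells[of ?a ?k l] by (auto simp: has_left_def)
  have "(x, y) \<in> gamma_cells ?S' \<longleftrightarrow> (x, y) = (?a, ?k) \<or> (x, y) \<in> gamma_cells ?S" for x y
  proof
    assume "(x, y) \<in> gamma_cells ?S'"
    then have g: "(x, y) \<in> ?S'" "1 \<le> x" "has_left ?S' x y"
        "\<And>x'. 1 \<le> x' \<Longrightarrow> x' < x \<Longrightarrow> \<not> has_left ?S' x' y"
      unfolding gamma_cells_def by auto
    have "j < y" using g(3) unfolding left'[OF g(2)] using lA lB lC by blast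
    then have "has_left ?S' ?a y" using left'[OF pos] by simp
    then have "x \<le> ?a" using g(4)[OF pos] by (meson not_le)
    have "(x, y) \<in> ?B \<or> (x, y) \<in> ?C"
      using g(1,2) \<open>j < y\<close> \<open>x \<le> ?a\<close> A[of x y] unfolding S' by auto
    moreover have up: "\<not> has_left ?S x' y" if "1 \<le> x'" "x' < x" for x'
      using g(4)[OF that] left[OF that(1)] left'[OF that(1)] by blast
    ultimately show "(x, y) = (?a, ?k) \<or> (x, y) \<in> gamma_cells ?S"
    proof (elim disjE)
      assume xy: "(x, y) \<in> ?B"
      then have "x = ?a" using B(1) \<open>x \<le> ?a\<close> by (simp add: le_antisym)
      show ?thesis
      proof (cases "y = ?k")
        case False
        then have "has_left ?B ?a y" using left_a B(3)[OF xy] by simp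
        then have "has_left ?S x y" using left[OF pos] \<open>x = ?a\<close> by blast
        moreover have "(x, y) \<in> ?S" using xy unfolding S by blast
        ultimately show ?thesis using up g(2) unfolding gamma_cells_def by blast
      qed (use \<open>x = ?a\<close> in simp)
    next
      assume xy: "(x, y) \<in> ?C"
      then have "x < ?a" using C by blast
      then have "has_left ?C x y" using g(3) unfolding left'[OF g(2)] using lA lB by fastforce
      then have "has_left ?S x y" using left[OF g(2)] by blast
      moreover have "(x, y) \<in> ?S" using xy unfolding S by blast
      ultimately show ?thesis using up g(2) unfolding gamma_cells_def by blast
    qed
  next
    assume "(x, y) = (?a, ?k) \<or> (x, y) \<in> gamma_cells ?S"
    then show "(x, y) \<in> gamma_cells ?S'"
    proof
      assume xy: "(x, y) = (?a, ?k)"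
      then have "(x, y) \<in> ?S'" unfolding S' by simp
      moreover have "has_left ?S' x y" using xy left'[OF pos] by simp
      moreover have "\<not> has_left ?S' x' y" if "1 \<le> x'" "x' < x" for x'
        using left'[OF that(1), of y] lA[of x' y] lB[of x' y] lC[of x' y] that xy by auto
      ultimately show ?thesis using xy pos unfolding gamma_cells_def by blast
    next
      assume "(x, y) \<in> gamma_cells ?S"
      then have g: "(x, y) \<in> ?S" "1 \<le> x" "has_left ?S x y"
          "\<And>x'. 1 \<le> x' \<Longrightarrow> x' < x \<Longrightarrow> \<not> has_left ?S x' y"
        unfolding gamma_cells_def by auto
      have "?k < y" using g(3) unfolding left[OF g(2)] using lB lC by blast
      have "(x, y) \<in> ?B \<or> (x, y) \<in> ?C" using g(1,2) unfolding S by auto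
      then have "x < ?a + leaves l" using B(2) C by (meson trans_less_add1)
      have "x \<le> ?a"
        using g(4)[OF pos] left[OF pos] left_a[OF \<open>?k < y\<close>] by (meson not_le)
      have "\<not> has_left ?S' x' y" if "1 \<le> x'" "x' < x" for x'
        using left'[OF that(1), of y] left[OF that(1), of y] lA[of x' y] g(4)[OF that] that \<open>x \<le> ?a\<close>
        by auto
      moreover have "has_left ?S' x y" using g(3) left[OF g(2)] left'[OF g(2)] by blast
      moreover have "(x, y) \<in> ?S'" using \<open>(x, y) \<in> ?B \<or> (x, y) \<in> ?C\<close> unfolding S' by blast
      ultimately show ?thesis using g(2) unfolding gamma_cells_def by blast
    qed
  qed
  then show ?thesis by auto
qed

lemma gamma_cells_shape_of:
  "gamma_cells (cells 0 j (shape_of ps)) = fst ` set (hills j ps)"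
proof (induction j ps rule: hills.induct)
  case (1 j)
  then show ?case by (auto simp: shape_of_def gamma_cells_def has_left_def)
next
  case (2 j ps)
  have "shape_of (Bar # ps) = Fork Tip (shape_of ps)"
    by (simp add: shape_of_def split: prod.splits)
  then show ?case using 2 gamma_cells_Bar by simp
next
  case (3 j g t ps)
  obtain l r where "sons_of ps = (l, r)" by (cases "sons_of ps")
  then show ?case using 3 gamma_cells_Hill[of j t l r] by (simp add: shape_of_def del: cells.simps)
qed

text \<open>Peel off the hill at the root of the left subtree or, if that is a leaf, the bar at the root of the
  right subtree; the Booleans are prescribed by \<open>G\<close>.\<close>

lemma ex_pieces:
  "\<exists>ps. sons_of ps = (l, r) \<and> (\<forall>(c, g)\<in>set (hills j ps). g \<longleftrightarrow> c \<in> G)"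
proof (induction "leaves l + leaves r" arbitrary: l r j rule: less_induct)
  case less
  show ?case
  proof (cases l)
    case (Fork t l')
    then obtain ps where ps: "sons_of ps = (l', r)"
        "\<forall>(c, g)\<in>set (hills (j + leaves t) ps). g \<longleftrightarrow> c \<in> G"
      using less.hyps[of l' r "j + leaves t"] leaves_pos[of t] by auto
    show ?thesis
      by (rule exI[of _ "Hill ((leaves r, j + leaves t) \<in> G) t # ps"]) (use ps Fork in auto)
  next
    case l: Tip
    show ?thesis
    proof (cases r)
      case Tip
      then show ?thesis using l by (intro exI[of _ "[]"]) simp
    next
      case (Fork l' r')
      then obtain ps where ps: "sons_of ps = (l', r')"
          "\<forall>(c, g)\<in>set (hills (j + 1) ps). g \<longleftrightarrow> c \<in> G"
        using less.hyps[of l' r' "j + 1"] l by auto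
      show ?thesis by (rule exI[of _ "Bar # ps"]) (use ps Fork l in auto)
    qed
  qed
qed

definition tableau_of_pieces :: "piece list \<Rightarrow> tableau" where
  "tableau_of_pieces ps = tableau_of (cells 0 0 (shape_of ps)) (gammas_of ps)"

lemma noncrossing_tree_gammas_pieces:
  "pieces_size ps = n \<Longrightarrow> noncrossing_tree_gammas n (cells 0 0 (shape_of ps)) (gammas_of ps)"
  by unfold_locales
     (force simp: noncrossing_tree_cells leaves_shape_of gamma_cells_shape_of gammas_of_def)+

lemma tableau_of_pieces_surj:
  assumes "T \<in> tableaux_no_delta_no_q n"
  shows "\<exists>ps. pieces_size ps = n \<and> T = tableau_of_pieces ps"
proof -
  interpret no_delta_no_q n T by unfold_locales (rule assms)
  let ?G = "{c. T c = Some Gamma}"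
  obtain t where t: "leaves t = n + 2" "S = cells 0 0 t"
    using noncrossing_tree_S unfolding noncrossing_tree_iff by auto
  then obtain l r where lr: "t = Fork l r" by (cases t) auto
  obtain ps where ps: "sons_of ps = (l, r)" "\<forall>(c, g)\<in>set (hills 0 ps). g \<longleftrightarrow> c \<in> ?G"
    using ex_pieces by blast
  have shape: "shape_of ps = t" using shape_of_eq[OF ps(1)] lr by simp
  have "?G \<subseteq> fst ` set (hills 0 ps)"
    using Gamma_subset gamma_cells_shape_of[of 0 ps] t shape by simp
  then have "gammas_of ps = ?G" using ps(2) by (fastforce simp: gammas_of_def)
  then have "T = tableau_of_pieces ps"
    using eq_tableau_of t shape by (simp add: tableau_of_pieces_def)
  moreover have "pieces_size ps = n" using leaves_shape_of[of ps] shape t by simp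
  ultimately show ?thesis by blast
qed

section \<open>The path of a sequence of hills and bars\<close>

text \<open>The steps of a piece before the negative factors are replaced: a bar is the leaf that ends a right
  chain followed by the next node of row 0.\<close>

definition traversal_piece :: "piece \<Rightarrow> lstep list" where
  "traversal_piece p = (case p of
     Bar \<Rightarrow> [(Down, None), (Up, None)]
   | Hill g t \<Rightarrow> (Up, Some (if g then Gamma else Alpha)) # map (\<lambda>s. (s, None)) (tree_word t))"

abbreviation labeled_step :: "tableau \<Rightarrow> nat \<times> bintree \<Rightarrow> lstep" where
  "labeled_step T v \<equiv> (node_step (snd v), node_label T v)"

text \<open>Inside the left subtree of a hill the left depth is at least 2, and no labels are assigned.\<close>

lemma preorder_bintree_at_deep:
  "1 < d \<Longrightarrow> map (labeled_step T) (preorder d (bintree_at i j t)) = map (\<lambda>s. (s, None)) (tree_word t)"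
  by (induction t arbitrary: d i j) auto

text \<open>The two down steps at the end come from the last leaf of the left subtree of the last node of row 0
  and from the leaf at the right end of row 0; these are the two external nodes to be omitted.\<close>

lemma preorder_bintree_at_sons:
  assumes "\<forall>(c, g)\<in>set (hills j ps). T c = Some (if g then Gamma else Alpha)"
    and "sons_of ps = (l, r)"
  shows "map (labeled_step T) (preorder 1 (bintree_at (leaves r) j l) @ preorder 0 (bintree_at 0 (j + leaves l) r))
     = concat (map traversal_piece ps) @ [(Down, None), (Down, None)]"
  using assms
proof (induction j ps arbitrary: l r rule: hills.induct)
  case (2 j ps)
  obtain l' r' where lr: "sons_of ps = (l', r')" by (cases "sons_of ps")
  show ?case using 2 lr by (auto simp: traversal_piece_def)
next
  case (3 j g t ps)
  obtain l' r' where lr: "sons_of ps = (l', r')" by (cases "sons_of ps")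
  show ?case using 3 lr by (auto simp: traversal_piece_def preorder_bintree_at_deep add.assoc)
qed auto

lemma tableau_of_pieces_at_hill:
  assumes "(c, g) \<in> set (hills 0 ps)"
  shows "tableau_of_pieces ps c = Some (if g then Gamma else Alpha)"
proof -
  interpret noncrossing_tree_gammas "pieces_size ps" "cells 0 0 (shape_of ps)" "gammas_of ps"
    by (rule noncrossing_tree_gammas_pieces) simp
  obtain x y where c: "c = (x, y)" by (cases c)
  have "c \<in> gamma_cells (cells 0 0 (shape_of ps))"
    unfolding gamma_cells_shape_of using assms by (force simp: image_iff)
  then have xy: "(x, y) \<in> cells 0 0 (shape_of ps)" "1 \<le> x" "has_left (cells 0 0 (shape_of ps)) x y"
    unfolding gamma_cells_def c by auto
  moreover have "1 \<le> y" using xy(3) by (auto simp: has_left_def)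
  moreover have "c \<in> gammas_of ps \<longleftrightarrow> g"
    using assms distinct_hills[of 0 ps] eq_key_imp_eq_value[of "hills 0 ps" c]
    by (auto simp: gammas_of_def)
  ultimately show ?thesis using S_left_iff[of x y] by (simp add: tableau_of_pieces_def T_eq_Some_iff c)
qed

lemma traversal_path_pieces:
  assumes "pieces_size ps = n"
  shows "traversal_path n (tableau_of_pieces ps) = concat (map traversal_piece ps)"
proof -
  interpret noncrossing_tree_gammas n "cells 0 0 (shape_of ps)" "gammas_of ps"
    by (rule noncrossing_tree_gammas_pieces[OF assms])
  let ?T = "tableau_of_pieces ps"
  obtain l r where lr: "sons_of ps = (l, r)" by (cases "sons_of ps")
  have hill_labels: "\<forall>(c, g)\<in>set (hills 0 ps). ?T c = Some (if g then Gamma else Alpha)"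
    using tableau_of_pieces_at_hill by blast
  have "tree_of n ?T = bintree_at 0 0 (shape_of ps)"
    unfolding tree_of_def tableau_of_pieces_def labeled_cells_T
    by (rule subtree_at_eq_bintree_at) (auto simp: leaves_shape_of assms quadrant_def)
  then have "map (labeled_step ?T) (tl (preorder 0 (tree_of n ?T)))
      = concat (map traversal_piece ps) @ [(Down, None), (Down, None)]"
    using preorder_bintree_at_sons[OF hill_labels lr] shape_of_eq[OF lr] by simp
  then show ?thesis
    unfolding traversal_path_def map_butlast by (simp add: butlast_append)
qed

text \<open>A single factor: a path that returns to the axis only at its end.\<close>

definition prime_word :: "step list \<Rightarrow> bool" where
  "prime_word w \<longleftrightarrow> w \<noteq> [] \<and> height w = 0 \<and> (\<forall>k. 0 < k \<and> k < length w \<longrightarrow> height (take k w) \<noteq> 0)"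

text \<open>The function \<open>p\<close> projects list elements to steps, so that this serves for the labeled steps of the
  traversal and, with the identity, for the steps of a lazy path.\<close>

lemma cut_at_axis_first:
  assumes "w \<noteq> []" "h + height (map p w) = 0"
    and "\<forall>k. 0 < k \<and> k < length w \<longrightarrow> h + height (take k (map p w)) \<noteq> 0"
  shows "cut_at_axis (step_y \<circ> p) h (w @ v) = w # cut_at_axis (step_y \<circ> p) 0 v"
  using assms
proof (induction w arbitrary: h)
  case (Cons s w)
  show ?case
  proof (cases "w = []")
    case True
    then show ?thesis using Cons.prems by simp
  next
    case False
    have "\<forall>k. 0 < k \<and> k < length w \<longrightarrow> (h + step_y (p s)) + height (take k (map p w)) \<noteq> 0"
    proof (intro allI impI)
      fix k assume "0 < k \<and> k < length w"
      then show "(h + step_y (p s)) + height (take k (map p w)) \<noteq> 0"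
        using Cons.prems(3)[rule_format, of "Suc k"] by (simp add: add.assoc)
    qed
    moreover have "h + step_y (p s) \<noteq> 0"
      using Cons.prems(3)[rule_format, of 1] False by simp
    ultimately show ?thesis
      using Cons.IH[OF False, of "h + step_y (p s)"] Cons.prems(2) by (simp add: add.assoc)
  qed
qed simp

lemma cut_at_axis_concat:
  "\<forall>f\<in>set fs. prime_word (map p f) \<Longrightarrow> cut_at_axis (step_y \<circ> p) 0 (concat fs) = fs"
  by (induction fs) (auto simp: prime_word_def cut_at_axis_first)

lemma height_take_hill:
  assumes "0 < k" "k < length (Up # tree_word t)"
  shows "0 < height (take k (Up # tree_word t))"
  using assms height_take_tree_word[of "k - 1" t] by (cases k) auto

lemma tree_word_not_Nil [simp]: "tree_word t \<noteq> []"
  by (cases t) auto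

lemma positive_factor_hill: "positive_factor (Up # tree_word t)"
  using height_take_hill[of _ t] by (simp add: positive_factor_def)

lemma not_negative_factor_hill: "\<not> negative_factor (Up # tree_word t)"
  unfolding negative_factor_def by (auto intro!: exI[of _ 1])

lemma negative_factor_reflected_hill: "negative_factor (map reflect_step (Up # tree_word t))"
  unfolding negative_factor_def height_map_reflect_take
proof (intro conjI allI impI)
  show "Flat \<notin> set (map reflect_step (Up # tree_word t))"
    using Flat_notin_tree_word[of t] by (auto simp: eq_commute[of Flat])
  fix k assume "0 < k \<and> k < length (map reflect_step (Up # tree_word t))"
  then show "- height (take k (Up # tree_word t)) < 0" using height_take_hill[of k t] by simp
qed

lemma prime_word_hill: "prime_word (Up # tree_word t)"
  unfolding prime_word_def
proof (intro conjI allI impI)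
  fix k assume "0 < k \<and> k < length (Up # tree_word t)"
  then show "height (take k (Up # tree_word t)) \<noteq> 0" using height_take_hill[of k t] by simp
qed simp_all

lemma prime_word_Flat: "prime_word [Flat]"
  by (auto simp: prime_word_def)

lemma prime_word_piece_word: "prime_word (piece_word p)"
proof (cases p)
  case (Hill g t)
  have "prime_word (map reflect_step (Up # tree_word t))"
    using prime_word_hill[of t] unfolding prime_word_def height_map_reflect_take height_reflect
    by (auto simp del: list.map)
  then show ?thesis using Hill prime_word_hill[of t] by simp
qed (simp add: prime_word_Flat)

lemma map_fst_traversal_piece:
  "map fst (traversal_piece p) = (case p of Bar \<Rightarrow> [Down, Up] | Hill g t \<Rightarrow> Up # tree_word t)"
  by (simp add: traversal_piece_def comp_def split: piece.splits)

lemma prime_word_Down_Up: "prime_word [Down, Up]"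
  by (auto simp: prime_word_def less_Suc_eq)

lemma negative_factor_Down_Up: "negative_factor [Down, Up]"
  by (auto simp: negative_factor_def less_Suc_eq)

lemma lfactors_traversal: "lfactors (concat (map traversal_piece ps)) = map traversal_piece ps"
  unfolding lfactors_def
  by (rule cut_at_axis_concat)
     (auto simp: map_fst_traversal_piece prime_word_hill prime_word_Down_Up split: piece.splits)

definition flattened_piece :: "piece \<Rightarrow> lstep list" where
  "flattened_piece p = (case p of Bar \<Rightarrow> [(Flat, None)] | Hill g t \<Rightarrow> traversal_piece p)"

lemma map_fst_flattened_piece:
  "map fst (flattened_piece p) = (case p of Bar \<Rightarrow> [Flat] | Hill g t \<Rightarrow> Up # tree_word t)"
  by (simp add: flattened_piece_def map_fst_traversal_piece split: piece.splits)

lemma flatten_negative_traversal: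
  "flatten_negative (concat (map traversal_piece ps)) = concat (map flattened_piece ps)"
  unfolding flatten_negative_def lfactors_traversal map_map
  by (rule arg_cong[of _ _ concat], rule map_cong)
     (auto simp: map_fst_traversal_piece flattened_piece_def negative_factor_Down_Up
        not_negative_factor_hill split: piece.splits)

lemma lfactors_flattened: "lfactors (concat (map flattened_piece ps)) = map flattened_piece ps"
  unfolding lfactors_def
  by (rule cut_at_axis_concat)
     (auto simp: map_fst_flattened_piece prime_word_hill prime_word_Flat split: piece.splits)

lemma reflect_gamma_flattened:
  "reflect_gamma (concat (map flattened_piece ps)) = pieces_word ps"
proof -
  have "(if positive_factor (map fst (flattened_piece p)) \<and> snd (hd (flattened_piece p)) = Some Gamma
      then map (reflect_step \<circ> fst) (flattened_piece p) else map fst (flattened_piece p))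
      = piece_word p" for p
  proof (cases p)
    case Bar
    then show ?thesis by (simp add: map_fst_flattened_piece positive_factor_def)
  next
    case (Hill g t)
    have "snd (hd (flattened_piece p)) = Some (if g then Gamma else Alpha)"
      using Hill by (simp add: flattened_piece_def traversal_piece_def)
    moreover have "map fst (flattened_piece p) = Up # tree_word t"
      using Hill by (simp add: map_fst_flattened_piece)
    ultimately show ?thesis
      using Hill positive_factor_hill[of t] map_map[of reflect_step fst "flattened_piece p"] by auto
  qed
  then show ?thesis
    unfolding reflect_gamma_def lfactors_flattened pieces_word_def by (simp add: comp_def)
qed

lemma Phi_tableau_of_pieces: "pieces_size ps = n \<Longrightarrow> Phi n (tableau_of_pieces ps) = pieces_word ps"
  by (simp add: Phi_def traversal_path_pieces flatten_negative_traversal reflect_gamma_flattened)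

text \<open>The map from sequences of pieces to tableaux is onto, and its composition with \<open>\<Phi>\<close> is a bijection
  onto the lazy paths; hence so is \<open>\<Phi>\<close>.\<close>

lemma bij_betw_Phi: "bij_betw (Phi n) (tableaux_no_delta_no_q n) (lazy_paths n)"
proof -
  let ?P = "{ps. pieces_size ps = n}"
  have "tableau_of_pieces ps \<in> tableaux_no_delta_no_q n" if "pieces_size ps = n" for ps
    using noncrossing_tree_gammas.T_in_tableaux[OF noncrossing_tree_gammas_pieces[OF that]]
    by (simp add: tableau_of_pieces_def)
  then have img: "tableaux_no_delta_no_q n = tableau_of_pieces ` ?P"
    using tableau_of_pieces_surj by blast
  have "inj_on (Phi n) (tableau_of_pieces ` ?P)"
    by (rule inj_onI) (auto simp: Phi_tableau_of_pieces dest: pieces_word_inject)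
  moreover have "Phi n ` tableau_of_pieces ` ?P = pieces_word ` ?P"
    unfolding image_image by (rule image_cong) (auto simp: Phi_tableau_of_pieces)
  moreover have "pieces_word ` ?P = lazy_paths n"
    using bij_betw_pieces_word by (simp add: bij_betw_def)
  ultimately show ?thesis unfolding img by (simp add: bij_betw_def)
qed

section \<open>Counting labels\<close>

lemma finite_cells [simp]: "finite (cells i j t)"
  by (induction t arbitrary: i j) auto

text \<open>This counts the left sons, of which there are as many as internal nodes. The left sons of a fork are
  those of its two subtrees and the root of the left one.\<close>

lemma card_has_above_cells:
  "card {(x, y). (x, y) \<in> cells i j t \<and> has_above (cells i j t) x y} = leaves t - 1"
proof (induction t arbitrary: i j)
  case Tip
  have "{(x, y). (x, y) \<in> cells i j Tip \<and> has_above (cells i j Tip) x y} = {}"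
    by (auto simp: has_above_def)
  then show ?case by (simp only: card.empty leaves.simps diff_self_eq_0)
next
  case (Fork l r)
  let ?L = "cells (i + leaves r) j l" and ?R = "cells i (j + leaves l) r"
  let ?AL = "{(x, y). (x, y) \<in> ?L \<and> has_above ?L x y}"
  let ?AR = "{(x, y). (x, y) \<in> ?R \<and> has_above ?R x y}"
  let ?F = "cells i j (Fork l r)"
  have root: "(i + leaves r, j) \<in> ?L" by simp
  have L: "i + leaves r \<le> x" "i < x" "y < j + leaves l" "j \<le> y" if "(x, y) \<in> ?L" for x y
    using cells_bounds[OF that] leaves_pos[of r] by linarith+
  have R: "x < i + leaves r" "j + leaves l \<le> y" "j < y" if "(x, y) \<in> ?R" for x y
    using cells_bounds[OF that] leaves_pos[of l] by linarith+
  have inL: "has_above ?F x y \<longleftrightarrow> (x, y) = (i + leaves r, j) \<or> has_above ?L x y"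
    if xy: "(x, y) \<in> ?L" for x y
  proof -
    have "has_above ?F x y \<longleftrightarrow> y = j \<or> has_above ?L x y"
      using L[OF xy] R(2)[of _ y] by (fastforce simp: has_above_def)
    moreover have "has_above ?L x j" if "y = j" "x \<noteq> i + leaves r"
      unfolding has_above_def using L(1)[OF xy] that root by (intro exI[of _ "i + leaves r"]) simp
    moreover have "\<not> has_above ?L x y \<Longrightarrow> y = j \<Longrightarrow> x = i + leaves r"
      using calculation(2) by blast
    ultimately show ?thesis by auto
  qed
  have inR: "has_above ?F x y \<longleftrightarrow> has_above ?R x y" if "(x, y) \<in> ?R" for x y
    using R[OF that] L(3)[of _ y] by (fastforce simp: has_above_def)
  have "\<not> has_above ?F i j" using L(2) cells_bounds[of _ j i "j + leaves l" r]
    by (fastforce simp: has_above_def)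
  then have "{(x, y). (x, y) \<in> ?F \<and> has_above ?F x y} = insert (i + leaves r, j) (?AL \<union> ?AR)"
    using inL inR root by auto
  moreover have "(i + leaves r, j) \<notin> ?AL \<union> ?AR"
    using L(1) R(3) by (fastforce simp: has_above_def)
  moreover have "?AL \<inter> ?AR = {}" using cells_disjoint_sons[of i r j l] by blast
  moreover have "finite ?AL" "finite ?AR" by (auto intro: finite_subset[OF _ finite_cells])
  moreover obtain a b where "leaves l = Suc a" "leaves r = Suc b"
    using leaves_neq_0 not0_implies_Suc by metis
  ultimately show ?case
    using Fork.IH(1)[of "i + leaves r" j] Fork.IH(2)[of i "j + leaves l"]
    by (simp add: card_Un_disjoint)
qed

text \<open>Mirroring a tree transposes its drawing, so that statements on right sons and on row 0 follow from
  those on left sons and on column 0.\<close>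

fun mirror :: "shape \<Rightarrow> shape" where
  "mirror Tip = Tip"
| "mirror (Fork l r) = Fork (mirror r) (mirror l)"

lemma leaves_mirror [simp]: "leaves (mirror t) = leaves t"
  by (induction t) auto

lemma cells_mirror: "(y, x) \<in> cells j i (mirror t) \<longleftrightarrow> (x, y) \<in> cells i j t"
  by (induction t arbitrary: i j) auto

lemma card_has_left_cells:
  "card {(x, y). (x, y) \<in> cells i j t \<and> has_left (cells i j t) x y} = leaves t - 1"
proof -
  have "has_above (cells j i (mirror t)) y x \<longleftrightarrow> has_left (cells i j t) x y" for x y
    by (simp add: has_above_def has_left_def cells_mirror)
  then have "{(x, y). (x, y) \<in> cells j i (mirror t) \<and> has_above (cells j i (mirror t)) x y}
      = prod.swap ` {(x, y). (x, y) \<in> cells i j t \<and> has_left (cells i j t) x y}"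
    by (force simp: cells_mirror image_iff)
  then show ?thesis using card_has_above_cells[of j i "mirror t"] by (simp add: card_image)
qed

text \<open>The number of internal nodes on the left spine.\<close>

fun left_spine :: "shape \<Rightarrow> nat" where
  "left_spine Tip = 0"
| "left_spine (Fork l r) = Suc (left_spine l)"

lemma card_first_column: "card {x. (x, j) \<in> cells i j t} = Suc (left_spine t)"
proof (induction t arbitrary: i)
  case (Fork l r)
  have "{x. (x, j) \<in> cells i j (Fork l r)} = insert i {x. (x, j) \<in> cells (i + leaves r) j l}"
    using cells_bounds[of _ j i "j + leaves l" r] by fastforce
  moreover have "i \<notin> {x. (x, j) \<in> cells (i + leaves r) j l}"
    using cells_bounds[of i j "i + leaves r" j l] by auto
  moreover have "finite {x. (x, j) \<in> cells (i + leaves r) j l}"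
    by (rule finite_subset[OF _ finite_imageI[of "cells (i + leaves r) j l" fst]]) force+
  ultimately show ?case using Fork.IH(1) by simp
qed simp

lemma card_first_row: "card {y. (i, y) \<in> cells i j t} = Suc (left_spine (mirror t))"
  using card_first_column[of i j "mirror t"] by (simp add: cells_mirror)

lemma left_spine_mirror_shape_of:
  "left_spine (mirror (shape_of ps)) = Suc (length (filter (\<lambda>p. p = Bar) ps))"
  by (induction ps rule: sons_of.induct) (auto simp: shape_of_def split: prod.splits)

lemma num_steps_simps [simp]:
  "num_steps s [] = 0"
  "num_steps s (s' # w) = (if s' = s then 1 else 0) + num_steps s w"
  "num_steps s (w @ w') = num_steps s w + num_steps s w'"
  by (auto simp: num_steps_def)

lemma num_steps_reflect: "num_steps s (map reflect_step w) = num_steps (reflect_step s) w"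
proof (induction w)
  case (Cons s' w)
  have "reflect_step s' = s \<longleftrightarrow> s' = reflect_step s" by (metis reflect_step_reflect)
  then show ?case using Cons by simp
qed simp

lemma num_steps_tree_word:
  "Suc (num_steps Up (tree_word t)) = leaves t" "num_steps Down (tree_word t) = leaves t"
  "num_steps Flat (tree_word t) = 0"
proof -
  show "num_steps Down (tree_word t) = leaves t" "num_steps Flat (tree_word t) = 0"
    by (induction t) auto
  show "Suc (num_steps Up (tree_word t)) = leaves t"
    by (induction t) (simp, force)
qed

lemma num_steps_pieces_word:
  "num_steps Up (pieces_word ps) + num_steps Flat (pieces_word ps) = pieces_size ps"
  "num_steps Down (pieces_word ps) = num_steps Up (pieces_word ps)"
  "num_steps Flat (pieces_word ps) = length (filter (\<lambda>p. p = Bar) ps)"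
proof -
  have piece: "num_steps Up (piece_word p) + num_steps Flat (piece_word p) = piece_size p \<and>
      num_steps Down (piece_word p) = num_steps Up (piece_word p) \<and>
      num_steps Flat (piece_word p) = (if p = Bar then 1 else 0)" for p
  proof (cases p)
    case (Hill g t)
    then show ?thesis using num_steps_tree_word[of t] by (simp add: num_steps_reflect)
  qed simp
  have "num_steps Up (pieces_word ps) + num_steps Flat (pieces_word ps) = pieces_size ps \<and>
      num_steps Down (pieces_word ps) = num_steps Up (pieces_word ps) \<and>
      num_steps Flat (pieces_word ps) = length (filter (\<lambda>p. p = Bar) ps)"
  proof (induction ps)
    case (Cons p ps)
    then show ?case using piece[of p] by simp
  qed simp
  then show "num_steps Up (pieces_word ps) + num_steps Flat (pieces_word ps) = pieces_size ps"
    "num_steps Down (pieces_word ps) = num_steps Up (pieces_word ps)"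
    "num_steps Flat (pieces_word ps) = length (filter (\<lambda>p. p = Bar) ps)"
    by simp_all
qed

lemma factors_pieces_word: "factors (pieces_word ps) = map piece_word ps"
  using cut_at_axis_concat[of "map piece_word ps" id] prime_word_piece_word
  by (simp add: factors_def pieces_word_def)

lemma negative_factor_piece_word: "negative_factor (piece_word p) \<longleftrightarrow> (\<exists>t. p = Hill True t)"
proof (cases p)
  case (Hill g t)
  then show ?thesis
    using negative_factor_reflected_hill[of t] not_negative_factor_hill[of t] by (cases g) auto
qed (simp add: negative_factor_def)

lemma num_negative_factors_pieces_word:
  "num_negative_factors (pieces_word ps) = card (gammas_of ps)"
proof -
  have "num_negative_factors (pieces_word ps) = length (filter snd (hills j ps))" for j
    unfolding num_negative_factors_def factors_pieces_word
    by (induction j ps rule: hills.induct) (auto simp: negative_factor_piece_word simp del: piece_word.simps)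
  moreover have "gammas_of ps = set (map fst (filter snd (hills 0 ps)))"
    by (force simp: gammas_of_def)
  moreover have "distinct (map fst (filter snd (hills 0 ps)))"
    by (rule distinct_map_filter[OF distinct_hills])
  ultimately show ?thesis by (metis distinct_card length_map)
qed

lemma takeWhile_tree_word:
  "length (takeWhile (\<lambda>s. s = Up) (tree_word t @ w)) = left_spine t"
proof (induction t arbitrary: w)
  case (Fork l r)
  then show ?case by simp
qed simp

text \<open>The up steps at the beginning of a hill are the nodes on the left spine, from the left son of the
  root on; the root itself is not traversed, whence the successor. For a reflected hill the initial run
  consists of down steps.\<close>

lemma initial_run_pieces_word: "Suc (initial_run (pieces_word ps)) = left_spine (shape_of ps)"
proof (cases ps)
  case Nil
  then show ?thesis by (simp add: initial_run_def shape_of_def)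
next
  case (Cons p ps')
  obtain l r where lr: "sons_of ps' = (l, r)" by (cases "sons_of ps'")
  have neg: "pieces_word ps \<noteq> [] \<and> negative_factor (hd (factors (pieces_word ps)))
      \<longleftrightarrow> (\<exists>t. p = Hill True t)"
    unfolding factors_pieces_word using Cons by (simp add: negative_factor_piece_word)
  show ?thesis
  proof (cases p)
    case Bar
    then show ?thesis using Cons lr neg by (simp add: initial_run_def shape_of_def)
  next
    case (Hill g t)
    have "takeWhile (\<lambda>s. s = Down) (map reflect_step (tree_word t) @ pieces_word ps')
        = takeWhile (\<lambda>s. s = Down) (map reflect_step (tree_word t @ map reflect_step (pieces_word ps')))"
      by (simp add: comp_def)
    also have "\<dots> = map reflect_step
        (takeWhile (\<lambda>s. s = Up) (tree_word t @ map reflect_step (pieces_word ps')))"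
    proof -
      have "(\<lambda>s. s = Down) \<circ> reflect_step = (\<lambda>s. s = Up)"
      proof
        fix s show "((\<lambda>s. s = Down) \<circ> reflect_step) s = (s = Up)" by (cases s) auto
      qed
      then show ?thesis unfolding takeWhile_map by simp
    qed
    finally show ?thesis
      using Cons lr neg Hill takeWhile_tree_word by (cases g) (simp_all add: initial_run_def shape_of_def)
  qed
qed

text \<open>The number of left sons is \<open>n + 1\<close>; they are the \<open>\<beta>\<close> labels and the cells of column 0 except the
  root. The number of right sons is \<open>n + 1\<close>; they are the \<open>\<alpha>\<close> and \<open>\<gamma>\<close> labels and the cells of row 0
  except the root. A path of size \<open>n\<close> has as many down as up steps, and the up steps and horizontal
  steps together number \<open>n\<close>.\<close>

lemma label_counts:
  assumes n: "pieces_size ps = n"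
  defines "T \<equiv> tableau_of_pieces ps" and "w \<equiv> pieces_word ps"
  shows "num_label Gamma T = num_negative_factors w"
    and "num_label Alpha T + num_label Gamma T = num_steps Up w"
    and "num_label Beta T + initial_run w = num_steps Down w + num_steps Flat w"
    and "card {j. column_indexed_by T j Beta} = num_steps Flat w"
    and "card {i. row_indexed_by T i Alpha \<or> row_indexed_by T i Gamma} = initial_run w"
proof -
  let ?S = "cells 0 0 (shape_of ps)"
  interpret noncrossing_tree_gammas n ?S "gammas_of ps"
    by (rule noncrossing_tree_gammas_pieces[OF n])
  have T: "T = tableau_of ?S (gammas_of ps)" by (simp add: T_def tableau_of_pieces_def)
  note T_Some = T_eq_Some_iff[folded T]
  interpret tab: no_delta_no_q n T
    by unfold_locales (simp add: T T_in_tableaux)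
  have fin: "finite {c. T c = Some l}" for l
    by (rule finite_subset[of _ ?S]) (auto simp: T_Some)

  show "num_label Gamma T = num_negative_factors w"
    unfolding num_label_def w_def T Gamma_cells_T num_negative_factors_pieces_word ..

  have run: "card {x. (x, 0) \<in> ?S} = initial_run w + 2"
    unfolding card_first_column w_def using initial_run_pieces_word[of ps] by simp
  have flat: "card {y. (0, y) \<in> ?S} = num_steps Flat w + 2"
    unfolding card_first_row left_spine_mirror_shape_of w_def num_steps_pieces_word by simp
  have size: "num_steps Up w + num_steps Flat w = n" "num_steps Down w = num_steps Up w"
    using num_steps_pieces_word[of ps] n by (simp_all add: w_def)
  have S: "labeled_cells n T = ?S" by (simp add: T labeled_cells_T)

  let ?C = "{j. column_indexed_by T j Beta}" and ?R = "{i. row_indexed_by T i Alpha \<or> row_indexed_by T i Gamma}"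
  have C: "?C \<subseteq> {1..n}"
  proof
    fix j assume "j \<in> ?C"
    then obtain i where "T (i, j) = Some Beta" "\<forall>i'<i. T (i', j) = None"
      by (auto simp: column_indexed_by_def)
    then show "j \<in> {1..n}" using tab.dom[of i j Beta] by simp
  qed
  have R: "?R \<subseteq> {1..n}"
  proof
    fix i assume "i \<in> ?R"
    then obtain j l where "T (i, j) = Some l" by (auto simp: row_indexed_by_def)
    then show "i \<in> {1..n}" using tab.dom[of i j l] by simp
  qed
  have "{y. (0, y) \<in> ?S} = insert 0 (insert (n + 1) ?C)"
    using tab.in_S_row_0 C unfolding S by auto
  moreover have "0 \<notin> ?C" "n + 1 \<notin> ?C" using C by auto
  moreover have "finite ?C" using C finite_subset by blast
  ultimately show "card ?C = num_steps Flat w" using flat by simp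
  have "{x. (x, 0) \<in> ?S} = insert 0 (insert (n + 1) ?R)"
    using tab.in_S_column_0 R unfolding S by auto
  moreover have "0 \<notin> ?R" "n + 1 \<notin> ?R" using R by auto
  moreover have "finite ?R" using R finite_subset by blast
  ultimately show "card ?R = initial_run w" using run by simp

  have above: "{(x, y). (x, y) \<in> ?S \<and> has_above ?S x y}
      = {c. T c = Some Beta} \<union> (\<lambda>x. (x, 0)) ` ({x. (x, 0) \<in> ?S} - {0})" (is "?L = ?R'")
  proof (rule set_eqI, clarify)
    fix x y :: nat
    show "(x, y) \<in> ?L \<longleftrightarrow> (x, y) \<in> ?R'"
      using root by (cases "y = 0"; cases "x = 0") (auto simp: T_Some has_above_def)
  qed
  have left: "{(x, y). (x, y) \<in> ?S \<and> has_left ?S x y}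
      = {c. T c = Some Alpha} \<union> {c. T c = Some Gamma} \<union> Pair 0 ` ({y. (0, y) \<in> ?S} - {0})" (is "?L = ?R'")
  proof (rule set_eqI, clarify)
    fix x y :: nat
    consider "x = 0" | "y = 0" "1 \<le> x" | "1 \<le> x" "1 \<le> y" by linarith
    then show "(x, y) \<in> ?L \<longleftrightarrow> (x, y) \<in> ?R'"
    proof cases
      case 1
      then show ?thesis using root by (auto simp: T_Some has_left_def)
    next
      case 2
      then show ?thesis by (auto simp: T_Some has_left_def)
    next
      case 3
      then show ?thesis using S_left_iff[of x y] by (auto simp: T_Some)
    qed
  qed
  have disj: "{c. T c = Some Beta} \<inter> (\<lambda>x. (x, 0)) ` ({x. (x, 0) \<in> ?S} - {0}) = {}"
    "({c. T c = Some Alpha} \<union> {c. T c = Some Gamma}) \<inter> Pair 0 ` ({y. (0, y) \<in> ?S} - {0}) = {}"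
    "{c. T c = Some Alpha} \<inter> {c. T c = Some Gamma} = {}"
    by (auto simp: T_Some)
  have fin0: "finite {x. (x, 0) \<in> ?S}" "finite {y. (0, y) \<in> ?S}"
    using run flat by (auto intro: card_ge_0_finite)
  have "card ((\<lambda>x. (x, 0::nat)) ` ({x. (x, 0) \<in> ?S} - {0})) = initial_run w + 1"
    using run root by (subst card_image) (auto simp: inj_on_def card_Diff_singleton)
  then have "leaves (shape_of ps) - 1 = num_label Beta T + (initial_run w + 1)"
    using card_has_above_cells[of 0 0 "shape_of ps"] fin[of Beta] fin0(1) disj(1)
    unfolding above num_label_def by (simp add: card_Un_disjoint)
  then show "num_label Beta T + initial_run w = num_steps Down w + num_steps Flat w"
    using size leaves_shape_of[of ps] n by simp
  have "card (Pair (0::nat) ` ({y. (0, y) \<in> ?S} - {0})) = num_steps Flat w + 1"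
    using flat root by (subst card_image) (auto simp: inj_on_def card_Diff_singleton)
  then have "leaves (shape_of ps) - 1 = num_label Alpha T + num_label Gamma T + (num_steps Flat w + 1)"
    using card_has_left_cells[of 0 0 "shape_of ps"] fin[of Alpha] fin[of Gamma] fin0(2) disj(2,3)
    unfolding left num_label_def by (simp add: card_Un_disjoint)
  then show "num_label Alpha T + num_label Gamma T = num_steps Up w"
    using size leaves_shape_of[of ps] n by simp
qed

theorem proposition2p6:
  fixes n :: nat
  assumes "1 \<le> n"
  shows "bij_betw (Phi n) (tableaux_no_delta_no_q n) (lazy_paths n) \<and>
    (\<forall>T\<in>tableaux_no_delta_no_q n.
       let D = int (num_steps Down (Phi n T));
           M = int (num_steps Up (Phi n T));
           A = int (initial_run (Phi n T));
           H = int (num_steps Flat (Phi n T));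
           N = int (num_negative_factors (Phi n T))
       in int (num_label Gamma T) = N \<and>
          int (num_label Alpha T) = M - N \<and>
          int (num_label Beta T) = D + H - A \<and>
          int (card {j. column_indexed_by T j Beta}) = H \<and>
          int (card {i. row_indexed_by T i Alpha \<or> row_indexed_by T i Gamma}) = A)"
proof (intro conjI ballI)
  show "bij_betw (Phi n) (tableaux_no_delta_no_q n) (lazy_paths n)" by (rule bij_betw_Phi)
next
  fix T assume "T \<in> tableaux_no_delta_no_q n"
  then obtain ps where ps: "pieces_size ps = n" "T = tableau_of_pieces ps"
    using tableau_of_pieces_surj by blast
  have Phi: "Phi n T = pieces_word ps"
    unfolding ps(2) by (rule Phi_tableau_of_pieces[OF ps(1)])
  note counts = label_counts[OF ps(1), folded ps(2)]
  show "let D = int (num_steps Down (Phi n T));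
           M = int (num_steps Up (Phi n T));
           A = int (initial_run (Phi n T));
           H = int (num_steps Flat (Phi n T));
           N = int (num_negative_factors (Phi n T))
       in int (num_label Gamma T) = N \<and>
          int (num_label Alpha T) = M - N \<and>
          int (num_label Beta T) = D + H - A \<and>
          int (card {j. column_indexed_by T j Beta}) = H \<and>
          int (card {i. row_indexed_by T i Alpha \<or> row_indexed_by T i Gamma}) = A"
    unfolding Let_def Phi using counts by linarith
qed

end
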